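(* Let $q,z,a,b,c,h$ be non-zero complex numbers with $|q|<1$, $|z|<1$, let $\tau\in(0,\infty)$, $w=\mathrm e^{i\eta}$, and suppose $h\sqrt{\frac{qa}{bcz}}\notin\{q^k:k\in\mathbb Z\}$. Assume there are no vanishing denominator factors and that the denominator factors in the integrand have maximum modulus less than unity, i.e. $\big|\tau\sqrt{\frac{qa}{bcz}}\big|,\big|\tau\sqrt{\frac{bcz}{qa}}\big|,\big|\sqrt{bcz}\big|/\tau,\big|\sqrt{qbcz}\big|/\tau,\big|\sqrt{\frac{qaz}{bc}}\big|/\tau<1$. Then $${}_5W_4(a;b,c;q,z)=\frac{(q,qa,\frac{qa}{bc},\frac{b^2c^2z^2}{qa};q)_\infty}{2\pi\,\vartheta(h,h\frac{qa}{bcz};q)\,(\frac{qa}b,\frac{qa}c,\frac{b^2c^2z^2}a;q)_\infty}$$ $$\times\int_{-\pi}^{\pi}\frac{\left(\big(\frac qh\sqrt{\frac{bcz}{qa}},\,h\sqrt{\frac{qa}{bcz}}\big)\frac\tau w,\ \big(h\sqrt{\frac{qa}{bcz}},\,\frac qh\sqrt{\frac{bcz}{qa}},\,\sqrt{\frac{qacz}b},\,\sqrt{\frac{qabz}c},\,\frac{\sqrt q\,(bcz)^{3/2}}{\sqrt a}\big)\frac w\tau;q\right)_\infty}{\left(\big(\sqrt{\frac{qa}{bcz}},\,\sqrt{\frac{bcz}{qa}}\big)\frac\tau w,\ \big(\pm\sqrt{bcz},\,\pm\sqrt{qbcz},\,\sqrt{\frac{qaz}{bc}}\big)\frac w\tau;q\right)_\infty}\,\mathrm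 d\eta.$$
   Context: Notation. $(a;q)_k=\prod_{j=0}^{k-1}(1-aq^j)$, $(a;q)_\infty=\prod_{j\ge0}(1-aq^j)$, $(a_1,\dots,a_r;q)_k=\prod_j(a_j;q)_k$ for $k\in\mathbb N_0\cup\{\infty\}$. In a list, $\pm x$ stands for the two entries $x,-x$, and $(x_1,\dots,x_k)t$ stands for the entries $x_1t,\dots,x_kt$. $\vartheta(x;q)=(x,q/x;q)_\infty$ for $x\ne0$, $\vartheta(x_1,\dots,x_k;q)=\prod_j\vartheta(x_j;q)$. ${}_{r+1}\phi_r(a_1,\dots,a_{r+1};b_1,\dots,b_r;q,z)=\sum_{k\ge0}\frac{(a_1,\dots,a_{r+1};q)_k}{(q,b_1,\dots,b_r;q)_k}z^k$ for $|z|<1$, and $${}_5W_4(a;b,c;q,z)={}_5\phi_4\!\left(a,\pm q\sqrt a,b,c;\pm\sqrt a,\tfrac{qa}b,\tfrac{qa}c;q,z\right).$$ Square roots are chosen consistently: fix square roots $\sqrt q,\sqrt a,\sqrt b,\sqrt c,\sqrt z$ and define all other half-integer powers of monomials multiplicatively from these. Convention "no vanishing denominator factors": every infinite $q$-shifted factorial and every theta function appearing in a denominator is non-zero (in particular $h,\,h\frac{qa}{bcz}\notin\{q^k:k\in\mathbb Z\}$), and no denominator parameter of any series lies in $\{q^{-k}:k\in\mathbb N_0\}$. *)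

theory Defs
  imports "HOL-Analysis.Analysis"
begin

text \<open>
  \<open>qpoch [a\<^sub>1, \<dots>, a\<^sub>r] q k\<close> is the product of the \<open>(a\<^sub>i; q)\<^sub>k\<close>, and \<open>qpoch_inf\<close> is the case
  \<open>k = \<infinity>\<close>. The infinite products converge for \<open>norm q < 1\<close>; \<open>prodinf\<close> has the value 0 if a
  factor vanishes.
\<close>

definition qpoch :: "complex list \<Rightarrow> complex \<Rightarrow> nat \<Rightarrow> complex" where
  "qpoch as q k = (\<Prod>a\<leftarrow>as. \<Prod>j<k. 1 - a * q ^ j)"

definition qpoch_inf :: "complex list \<Rightarrow> complex \<Rightarrow> complex" where
  "qpoch_inf as q = (\<Prod>a\<leftarrow>as. \<Prod>j. 1 - a * q ^ j)"

definition qtheta :: "complex list \<Rightarrow> complex \<Rightarrow> complex" where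
  "qtheta xs q = (\<Prod>x\<leftarrow>xs. qpoch_inf [x, q / x] q)"

definition qhyp :: "complex list \<Rightarrow> complex list \<Rightarrow> complex \<Rightarrow> complex \<Rightarrow> complex" where
  "qhyp as bs q z = (\<Sum>k. qpoch as q k / qpoch (q # bs) q k * z ^ k)"

text \<open>
  In both definitions below \<open>ra\<close> is the chosen square root of \<open>a\<close>; the list in the first
  one is the list of denominator parameters of the series.
\<close>

definition W54_denoms :: "complex \<Rightarrow> complex \<Rightarrow> complex \<Rightarrow> complex \<Rightarrow> complex \<Rightarrow> complex list" where
  "W54_denoms ra a b c q = [ra, - ra, q * a / b, q * a / c]"

definition W54 :: "complex \<Rightarrow> complex \<Rightarrow> complex \<Rightarrow> complex \<Rightarrow> complex \<Rightarrow> complex \<Rightarrow> complex" where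
  "W54 ra a b c q z = qhyp [a, q * ra, - (q * ra), b, c] (W54_denoms ra a b c q) q z"

end

theory Submission
  imports Defs
begin

text \<open>
  Put \<open>t = sqrt (qa / (bcz))\<close> and \<open>s = sqrt (bcz)\<close>, so that \<open>s\<^sup>2 t\<^sup>2 = q a\<close>, and integrate in the variable
  \<open>v = t w / \<tau>\<close>, which runs over a circle. Four of the denominator factors combine to
  \<open>(s\<^sup>2 w\<^sup>2 / \<tau>\<^sup>2; q)\<close> (\<open>qinf_quadruple\<close>), and with \<open>p = t\<^sup>2\<close> and \<open>x = s\<^sup>2 / t\<^sup>2\<close> the integrand becomes the
  theta kernel \<open>kern q h p v = theta (h v) theta (h p / v) / ((p/v; q) (1/v; q))\<close> times
  \<open>(c z v, b z v, q x v; q) / (z v, x v\<^sup>2; q)\<close>. The square roots have disappeared.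

  The part of the integrand that depends on \<open>b\<close> and \<open>c\<close> separately is \<open>(b z v, c z v; q) / (z v; q)\<close>. This is
  what the summation formula for the nonterminating very-well-poised 6phi5 series with parameters
  \<open>a; b, c, p/v\<close> produces (\<open>w65_sum\<close>). Up to a constant factor common to all terms, the integrand is
  therefore a series whose \<open>k\<close>-th term is the \<open>k\<close>-th term of the series on the left-hand side of the
  theorem, times a function of \<open>v\<close> free of \<open>b\<close> and \<open>c\<close> for given \<open>p\<close> and \<open>x\<close>. By the quasi-periodicity of theta that function is, up to a constant, of the same form for
  every \<open>k\<close>, with \<open>p\<close> replaced by \<open>p q\<^sup>k\<close>. The integral representation therefore amounts to one evaluation,
  \<open>kern_balanced_mean\<close>: the mean of \<open>kern q h p v (p x v, q x v; q) / (x v\<^sup>2; q)\<close> over the circle is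
  \<open>theta h theta (h p) / ((q; q) (1 - x))\<close>, and the constants from quasi-periodicity make the contributions
  of all \<open>k\<close> equal.

  For this evaluation expand in powers of \<open>x\<close> by the q-binomial theorem. The coefficients are combinations of
  the moments of the kernel, which are the Rogers-Szego polynomials times the zeroth moment (\<open>kern_moment\<close>);
  an alternating sum of these polynomials (\<open>rogers_szego_alternating_sum\<close>) shows that all powers of \<open>x\<close> have the
  same coefficient, whence the geometric series. The zeroth moment (\<open>theta_kernel_mean\<close>) is the constant term
  of a Laurent series: the triple product expands both theta functions, Euler's series expands the
  denominator, and the coefficients are collected by the Durfee rectangle identity
  \<open>\<Sum>n. q\<^bsup>n(n+k)\<^esup> / ((q; q)\<^sub>n (q; q)\<^bsub>n+k\<^esub>) = 1 / (q; q)\<close>. The same identity yields the triple product.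
\<close>

section \<open>q-shifted factorials and the q-binomial theorem\<close>

definition qfac :: "complex \<Rightarrow> complex \<Rightarrow> nat \<Rightarrow> complex" where
  "qfac q a n = (\<Prod>j<n. 1 - a * q ^ j)"

definition qinf :: "complex \<Rightarrow> complex \<Rightarrow> complex" where
  "qinf q a = (\<Prod>j. 1 - a * q ^ j)"

definition theta :: "complex \<Rightarrow> complex \<Rightarrow> complex" where
  "theta q x = qinf q x * qinf q (q / x)"

text \<open>
  The homogeneous form \<open>\<alpha>\<^sup>n (A/\<alpha>; q)\<^sub>n\<close>. It stays meaningful at \<open>\<alpha> = 0\<close>, where it is
  \<open>(-A)\<^sup>n q\<^bsup>n(n-1)/2\<^esup>\<close>, so that the q-binomial theorem below contains both of Euler's series, and it never
  divides by a vanishing variable.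
\<close>

definition hfac :: "complex \<Rightarrow> complex \<Rightarrow> complex \<Rightarrow> nat \<Rightarrow> complex" where
  "hfac q \<alpha> A n = (\<Prod>j<n. \<alpha> - A * q ^ j)"

lemma qfac_0 [simp]: "qfac q a 0 = 1"
  by (simp add: qfac_def)

lemma qfac_Suc: "qfac q a (Suc n) = qfac q a n * (1 - a * q ^ n)"
  by (simp add: qfac_def)

lemma qfac_add: "qfac q a (m + n) = qfac q a m * qfac q (a * q ^ m) n"
  by (induction n) (simp_all add: qfac_Suc power_add mult_ac)

lemma qfac_Suc_shift: "qfac q a (Suc n) = (1 - a) * qfac q (a * q) n"
  using qfac_add[of q a 1 n] by (simp add: qfac_Suc)

lemma hfac_0 [simp]: "hfac q \<alpha> A 0 = 1"
  by (simp add: hfac_def)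

lemma hfac_Suc: "hfac q \<alpha> A (Suc n) = hfac q \<alpha> A n * (\<alpha> - A * q ^ n)"
  by (simp add: hfac_def)

lemma hfac_scale: "hfac q (c * \<alpha>) (c * A) n = c ^ n * hfac q \<alpha> A n"
  by (induction n) (simp_all add: hfac_Suc algebra_simps)

lemma hfac_one: "hfac q 1 A n = qfac q A n"
  by (simp add: hfac_def qfac_def)

lemma hfac_alpha_zero: "hfac q \<alpha> 0 n = \<alpha> ^ n"
  by (induction n) (simp_all add: hfac_Suc)

lemma qfac_eq_0_iff: "qfac q a n = 0 \<longleftrightarrow> (\<exists>j<n. a * q ^ j = 1)"
  by (auto simp: qfac_def)

context
  fixes q :: complex
  assumes q1: "norm q < 1"
begin

lemma qfac_convergent_prod: "convergent_prod (\<lambda>j. 1 - a * q ^ j)"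
proof -
  have "summable (\<lambda>j. norm a * norm q ^ j)"
    by (intro summable_mult summable_geometric) (use q1 in simp)
  then have "abs_convergent_prod (\<lambda>j. 1 - a * q ^ j)"
    by (intro summable_imp_abs_convergent_prod) (simp add: norm_mult norm_power)
  then show ?thesis by (rule abs_convergent_prod_imp_convergent_prod)
qed

lemma qfac_tendsto_qinf: "qfac q a \<longlonglongrightarrow> qinf q a"
proof -
  have "(\<lambda>n. qfac q a (Suc n)) \<longlonglongrightarrow> qinf q a"
    using convergent_prod_LIMSEQ[OF qfac_convergent_prod[of a]]
    by (simp add: qfac_def qinf_def lessThan_Suc_atMost)
  then show ?thesis by (rule LIMSEQ_imp_Suc)
qed

lemma qinf_split: "qinf q a = qfac q a n * qinf q (a * q ^ n)"
proof -
  have "(\<lambda>m. qfac q a n * qfac q (a * q ^ n) m) \<longlonglongrightarrow> qfac q a n * qinf q (a * q ^ n)"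
    by (intro tendsto_intros qfac_tendsto_qinf)
  moreover have "(\<lambda>m. qfac q a (m + n)) \<longlonglongrightarrow> qinf q a"
    by (rule LIMSEQ_ignore_initial_segment[OF qfac_tendsto_qinf])
  ultimately show ?thesis
    by (simp add: qfac_add[symmetric] add.commute[of _ n] LIMSEQ_unique)
qed

lemma qinf_step: "qinf q a = (1 - a) * qinf q (a * q)"
  using qinf_split[of a 1] by (simp add: qfac_Suc)

lemma qinf_0 [simp]: "qinf q 0 = 1"
  by (simp add: qinf_def)

lemma qinf_eq_0_iff: "qinf q a = 0 \<longleftrightarrow> (\<exists>j. a * q ^ j = 1)"
proof
  assume "qinf q a = 0"
  then show "\<exists>j. a * q ^ j = 1"
    using prodinf_nonzero[OF qfac_convergent_prod[of a]] by (auto simp: qinf_def)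
next
  assume "\<exists>j. a * q ^ j = 1"
  then obtain j where "a * q ^ j = 1" by blast
  then have "qfac q a (Suc j) = 0" by (simp add: qfac_Suc)
  then show "qinf q a = 0" by (subst qinf_split[of a "Suc j"]) simp
qed

lemma mult_power_ne_1: "norm a < 1 \<Longrightarrow> a * q ^ j \<noteq> 1"
proof
  assume a: "norm a < 1" and eq: "a * q ^ j = 1"
  have "norm (a * q ^ j) \<le> norm a * 1"
    unfolding norm_mult norm_power using q1 by (intro mult_left_mono power_le_one) auto
  with a eq show False by simp
qed

lemma qinf_nonzero: "norm a < 1 \<Longrightarrow> qinf q a \<noteq> 0"
  using mult_power_ne_1 by (auto simp: qinf_eq_0_iff)

lemma qfac_nonzero: "norm a < 1 \<Longrightarrow> qfac q a n \<noteq> 0"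
  using mult_power_ne_1 by (auto simp: qfac_eq_0_iff)

lemma qfac_q_nonzero [simp]: "qfac q q n \<noteq> 0"
  using q1 by (rule qfac_nonzero)

lemma norm_qfac_le: "norm (qfac q a n) \<le> exp (norm a / (1 - norm q))"
proof -
  have "norm (qfac q a n) = (\<Prod>j<n. norm (1 - a * q ^ j))"
    by (simp add: qfac_def prod_norm)
  also have "\<dots> \<le> (\<Prod>j<n. exp (norm a * norm q ^ j))"
  proof (intro prod_mono conjI)
    fix j
    have "norm (1 - a * q ^ j) \<le> 1 + norm a * norm q ^ j"
      using norm_triangle_ineq4[of 1 "a * q ^ j"] by (simp add: norm_mult norm_power)
    also have "\<dots> \<le> exp (norm a * norm q ^ j)"
      by (rule exp_ge_add_one_self)
    finally show "norm (1 - a * q ^ j) \<le> exp (norm a * norm q ^ j)" .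
  qed auto
  also have "\<dots> = exp (norm a * (\<Sum>j<n. norm q ^ j))"
    by (simp add: exp_sum sum_distrib_left)
  also have "\<dots> \<le> exp (norm a * (1 / (1 - norm q)))"
  proof -
    have "(\<Sum>j<n. norm q ^ j) \<le> (\<Sum>j. norm q ^ j)"
      using q1 by (intro sum_le_suminf summable_geometric) auto
    then show ?thesis using q1
      by (simp add: suminf_geometric mult_left_mono del: times_divide_eq_right)
  qed
  finally show ?thesis by simp
qed

lemma norm_qinf_le: "norm (qinf q a) \<le> exp (norm a / (1 - norm q))"
  using tendsto_norm[OF qfac_tendsto_qinf[of a]] norm_qfac_le
  by (intro LIMSEQ_le_const2) auto

text \<open>
  A convergent product without zero factors has a nonzero limit, so its partial products stay away
  from zero.
\<close>

lemma inverse_qfac_bounded: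
  assumes "\<And>j. a * q ^ j \<noteq> 1"
  obtains B where "B > 0" "\<And>n. norm (1 / qfac q a n) \<le> B"
proof -
  have "qinf q a \<noteq> 0" using assms by (auto simp: qinf_eq_0_iff)
  then have "(\<lambda>n. 1 / qfac q a n) \<longlonglongrightarrow> 1 / qinf q a"
    by (intro tendsto_intros qfac_tendsto_qinf)
  then have "Bseq (\<lambda>n. 1 / qfac q a n)"
    by (intro convergent_imp_Bseq convergentI)
  then show ?thesis using that by (auto simp: Bseq_def)
qed

lemma hfac_bound:
  assumes "0 < \<rho>" "norm \<alpha> \<le> \<rho>"
  shows "norm (hfac q \<alpha> A n) \<le> \<rho> ^ n * exp (norm A / \<rho> / (1 - norm q))"
proof -
  have "norm (hfac q \<alpha> A n) = (\<Prod>j<n. norm (\<alpha> - A * q ^ j))"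
    by (simp add: hfac_def prod_norm)
  also have "\<dots> \<le> (\<Prod>j<n. \<rho> * exp (norm A / \<rho> * norm q ^ j))"
  proof (intro prod_mono conjI)
    fix j
    have "norm (\<alpha> - A * q ^ j) \<le> norm \<alpha> + norm A * norm q ^ j"
      using norm_triangle_ineq4[of \<alpha> "A * q ^ j"] by (simp add: norm_mult norm_power)
    also have "\<dots> \<le> \<rho> * (1 + norm A / \<rho> * norm q ^ j)"
      using assms by (simp add: field_simps)
    also have "\<dots> \<le> \<rho> * exp (norm A / \<rho> * norm q ^ j)"
      using assms by (intro mult_left_mono exp_ge_add_one_self) auto
    finally show "norm (\<alpha> - A * q ^ j) \<le> \<rho> * exp (norm A / \<rho> * norm q ^ j)" .
  qed auto
  also have "\<dots> = \<rho> ^ n * exp (norm A / \<rho> * (\<Sum>j<n. norm q ^ j))"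
    by (simp add: exp_sum sum_distrib_left prod.distrib)
  also have "\<dots> \<le> \<rho> ^ n * exp (norm A / \<rho> * (1 / (1 - norm q)))"
  proof -
    have "(\<Sum>j<n. norm q ^ j) \<le> (\<Sum>j. norm q ^ j)"
      using q1 by (intro sum_le_suminf summable_geometric) auto
    then have "(\<Sum>j<n. norm q ^ j) \<le> 1 / (1 - norm q)"
      using q1 by (simp add: suminf_geometric)
    then show ?thesis using assms
      by (intro mult_left_mono iffD2[OF exp_le_cancel_iff]) auto
  qed
  finally show ?thesis by simp
qed

text \<open>
  The majorant is uniform in \<open>\<alpha>\<close> and \<open>A\<close>, since both will depend on the point of a circle over which the
  series is integrated termwise.
\<close>

lemma qbinomial_term_bound:
  assumes "0 < \<rho>"
  obtains C where "C > 0"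
    "\<And>\<alpha> A n. norm \<alpha> \<le> \<rho> \<Longrightarrow> norm A \<le> R \<Longrightarrow> norm (hfac q \<alpha> A n / qfac q q n) \<le> C * \<rho> ^ n"
proof -
  obtain B where B: "B > 0" "\<And>n. norm (1 / qfac q q n) \<le> B"
    using inverse_qfac_bounded[of q] mult_power_ne_1 q1 by metis
  define C where "C = exp (R / \<rho> / (1 - norm q)) * B"
  have "norm (hfac q \<alpha> A n / qfac q q n) \<le> C * \<rho> ^ n" if "norm \<alpha> \<le> \<rho>" "norm A \<le> R" for \<alpha> A n
  proof -
    have "norm (hfac q \<alpha> A n / qfac q q n) = norm (hfac q \<alpha> A n) * norm (1 / qfac q q n)"
      by (simp add: norm_divide)
    also have "\<dots> \<le> (\<rho> ^ n * exp (norm A / \<rho> / (1 - norm q))) * B"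
      using assms that by (intro mult_mono hfac_bound B) auto
    also have "\<dots> \<le> (\<rho> ^ n * exp (R / \<rho> / (1 - norm q))) * B"
      using assms that B q1 by (intro mult_right_mono mult_left_mono) (auto intro!: divide_right_mono)
    finally show ?thesis by (simp add: C_def mult_ac)
  qed
  with that[of C] B show ?thesis by (simp add: C_def)
qed

lemma qbinomial_abs_summable:
  assumes "norm \<alpha> < 1"
  shows "summable (\<lambda>n. norm (hfac q \<alpha> A n / qfac q q n))"
proof -
  obtain \<rho> where \<rho>: "norm \<alpha> < \<rho>" "\<rho> < 1" using assms dense by blast
  then have "\<rho> > 0" using norm_ge_zero[of \<alpha>] by linarith
  then obtain C where C: "\<And>\<alpha> A' n. norm \<alpha> \<le> \<rho> \<Longrightarrow> norm A' \<le> norm A \<Longrightarrow> norm (hfac q \<alpha> A' n / qfac q q n) \<le> C * \<rho> ^ n"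
    using qbinomial_term_bound[of \<rho> "norm A"] by metis
  show ?thesis
    by (rule summable_comparison_test'[of "\<lambda>n. C * \<rho> ^ n" 0])
       (use C[of \<alpha> A] \<rho> \<open>\<rho> > 0\<close> in \<open>auto intro!: summable_mult summable_geometric\<close>)
qed

text \<open>
  With \<open>g x\<close> the series with an extra factor \<open>x\<^sup>n\<close>, comparing coefficients gives
  \<open>(1 - \<alpha> x) g x = (1 - A x) g (q x)\<close>. Iteration and continuity of \<open>g\<close> at 0 turn this into the quotient
  of the two infinite products.
\<close>

theorem qbinomial:
  assumes "norm \<alpha> < 1"
  shows "(\<lambda>n. hfac q \<alpha> A n / qfac q q n) sums (qinf q A / qinf q \<alpha>)"
proof -
  define c where "c = (\<lambda>n. hfac q \<alpha> A n / qfac q q n)"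
  define g where "g = (\<lambda>x. \<Sum>n. c n * x ^ n)"
  have summ1: "summable (\<lambda>n. norm (c n))"
    unfolding c_def by (rule qbinomial_abs_summable[OF assms])
  have summ: "summable (\<lambda>n. c n * x ^ n)" if "norm x \<le> 1" for x
  proof (rule summable_comparison_test'[OF summ1, of 0])
    fix n
    show "norm (c n * x ^ n) \<le> norm (c n)"
      using that by (simp add: norm_mult norm_power mult_left_le power_le_one)
  qed
  have step: "(1 - \<alpha> * x) * g x = (1 - A * x) * g (q * x)" if x: "norm x \<le> 1" for x
  proof -
    have qx: "norm (q * x) \<le> 1"
      using x q1 by (simp add: norm_mult mult_le_one)
    note s = summ[OF x, THEN summable_sums] summ[OF qx, THEN summable_sums]
    have "(\<lambda>n. \<alpha> * x * (c n * x ^ n) - A * x * (c n * (q * x) ^ n)) sums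
            (\<alpha> * x * g x - A * x * g (q * x))"
      unfolding g_def by (intro sums_diff sums_mult s)
    moreover have "\<alpha> * x * (c n * x ^ n) - A * x * (c n * (q * x) ^ n) =
        c (Suc n) * x ^ Suc n - c (Suc n) * (q * x) ^ Suc n" for n
    proof -
      have "c (Suc n) * (1 - q * q ^ n) = c n * (\<alpha> - A * q ^ n)"
        using qfac_q_nonzero[of "Suc n"] by (simp add: c_def hfac_Suc qfac_Suc)
      then have "c (Suc n) * (1 - q * q ^ n) * x ^ Suc n = c n * (\<alpha> - A * q ^ n) * x ^ Suc n"
        by (rule arg_cong)
      then show ?thesis by (simp add: power_mult_distrib algebra_simps)
    qed
    moreover have "(\<lambda>n. c (Suc n) * x ^ Suc n - c (Suc n) * (q * x) ^ Suc n) sums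
        ((g x - c 0 * x ^ 0) - (g (q * x) - c 0 * (q * x) ^ 0))"
      using s unfolding g_def by (intro sums_diff) (subst sums_Suc_iff, simp)+
    ultimately have "\<alpha> * x * g x - A * x * g (q * x) = g x - g (q * x)"
      by (simp add: sums_unique2)
    then show ?thesis by (simp add: algebra_simps)
  qed
  have iter: "qfac q \<alpha> n * g 1 = qfac q A n * g (q ^ n)" for n
  proof (induction n)
    case (Suc n)
    have "norm (q ^ n) \<le> 1" using q1 by (simp add: norm_power power_le_one)
    note st = step[OF this]
    have "qfac q \<alpha> (Suc n) * g 1 = (1 - \<alpha> * q ^ n) * (qfac q \<alpha> n * g 1)"
      by (simp add: qfac_Suc)
    also have "\<dots> = qfac q A n * ((1 - \<alpha> * q ^ n) * g (q ^ n))"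
      unfolding Suc by simp
    also have "\<dots> = qfac q A (Suc n) * g (q ^ Suc n)"
      unfolding st by (simp add: qfac_Suc)
    finally show ?case .
  qed simp
  have "isCont g 0"
    unfolding g_def by (rule isCont_powser[of _ 1]) (use summ[of 1] in auto)
  moreover have "(\<lambda>n. q ^ n) \<longlonglongrightarrow> 0"
    using q1 by (rule LIMSEQ_power_zero)
  ultimately have "(\<lambda>n. g (q ^ n)) \<longlonglongrightarrow> g 0"
    by (rule isCont_tendsto_compose)
  moreover have "g 0 = 1"
    unfolding g_def using powser_zero[of c] by (simp add: c_def)
  ultimately have "(\<lambda>n. qfac q A n * g (q ^ n)) \<longlonglongrightarrow> qinf q A * 1"
    by (intro tendsto_mult qfac_tendsto_qinf) simp
  moreover have "(\<lambda>n. qfac q \<alpha> n * g 1) \<longlonglongrightarrow> qinf q \<alpha> * g 1"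
    by (intro tendsto_intros qfac_tendsto_qinf)
  ultimately have "qinf q \<alpha> * g 1 = qinf q A"
    unfolding iter by (simp add: LIMSEQ_unique)
  then have "g 1 = qinf q A / qinf q \<alpha>"
    using qinf_nonzero[OF assms] by (simp add: field_simps)
  with summ[of 1] show ?thesis
    by (simp add: g_def c_def sums_iff)
qed

lemma hfac_zero_eq: "hfac q 0 A n = (- A) ^ n * q ^ (n * (n - 1) div 2)"
proof (induction n)
  case (Suc n)
  have "n + n * (n - 1) div 2 = Suc n * (Suc n - 1) div 2"
    by (cases n) (auto simp: algebra_simps)
  then have "q ^ (Suc n * (Suc n - 1) div 2) = q ^ n * q ^ (n * (n - 1) div 2)"
    by (metis power_add)
  then show ?case by (simp only: hfac_Suc Suc power_Suc) simp
qed simp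

lemma euler_series: "(\<lambda>n. hfac q 0 A n / qfac q q n) sums qinf q A"
  using qbinomial[of 0 A] by simp

text \<open>
  By Euler's series \<open>qinf q\<close> is an everywhere convergent power series.
\<close>

lemma continuous_qinf: "continuous_on S (qinf q)"
proof -
  define c where "c n = hfac q 0 1 n / qfac q q n" for n
  have c: "(\<lambda>n. c n * A ^ n) sums qinf q A" for A
    using euler_series[of A] hfac_scale[of q A 0 1] by (simp add: c_def mult.commute)
  then have eq: "qinf q = (\<lambda>A. \<Sum>n. c n * A ^ n)"
    by (simp add: fun_eq_iff sums_iff)
  have "summable (\<lambda>n. c n * A ^ n)" for A
    using c sums_summable by blast
  then have "isCont (qinf q) x" for x
    unfolding eq by (rule isCont_powser_converges_everywhere)
  then show ?thesis by (simp add: continuous_at_imp_continuous_on)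
qed

lemma continuous_on_qinf [continuous_intros]:
  "continuous_on S f \<Longrightarrow> continuous_on S (\<lambda>x. qinf q (f x))"
  using continuous_on_compose2[OF continuous_qinf] by blast

end

text \<open>
  This removes the square roots from the integrand: the four factors with parameters
  \<open>\<plusminus>a, \<plusminus>r a\<close> are the even- and odd-indexed factors of one product in \<open>a\<^sup>2\<close>.
\<close>

lemma qinf_quadruple:
  assumes q1: "norm q < 1" and r: "r\<^sup>2 = q"
  shows "qinf q a * qinf q (- a) * qinf q (r * a) * qinf q (- (r * a)) = qinf q (a\<^sup>2)"
proof -
  have fin: "qfac q a n * qfac q (- a) n * qfac q (r * a) n * qfac q (- (r * a)) n = qfac q (a\<^sup>2) (2 * n)" for n
  proof (induction n)
    case (Suc n)
    have double: "2 * Suc n = Suc (Suc (2 * n))" by simp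
    have "(1 - a * q ^ n) * (1 - (- a) * q ^ n) * (1 - r * a * q ^ n) * (1 - (- (r * a)) * q ^ n) =
        (1 - a\<^sup>2 * q ^ (2 * n)) * (1 - a\<^sup>2 * q ^ Suc (2 * n))"
    proof -
      have e: "q ^ (2 * n) = (q ^ n)\<^sup>2" "q ^ Suc (2 * n) = r\<^sup>2 * (q ^ n)\<^sup>2"
        by (simp_all add: r power_mult mult.commute[of 2 n])
      have "(1 - a * y) * (1 - (- a) * y) * (1 - r * a * y) * (1 - (- (r * a)) * y) =
          (1 - a\<^sup>2 * y\<^sup>2) * (1 - a\<^sup>2 * (r\<^sup>2 * y\<^sup>2))" for y
        by algebra
      then show ?thesis unfolding e .
    qed
    from arg_cong2[of _ _ _ _ "(*)", OF Suc this] show ?case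
      unfolding double qfac_Suc by (simp only: mult_ac)
  qed simp
  have "(\<lambda>n. qfac q (a\<^sup>2) (2 * n)) \<longlonglongrightarrow> qinf q (a\<^sup>2)"
    using LIMSEQ_subseq_LIMSEQ[OF qfac_tendsto_qinf[OF q1, of "a\<^sup>2"], of "\<lambda>n. 2 * n"]
    by (simp add: o_def strict_mono_def)
  moreover have "(\<lambda>n. qfac q (a\<^sup>2) (2 * n)) \<longlonglongrightarrow> qinf q a * qinf q (- a) * qinf q (r * a) * qinf q (- (r * a))"
    unfolding fin[symmetric] by (intro tendsto_intros qfac_tendsto_qinf q1)
  ultimately show ?thesis by (rule LIMSEQ_unique[symmetric])
qed

lemma hfac_zero_shift: "hfac q 0 z (Suc n) = - z * hfac q 0 (z * q) n"
  unfolding hfac_def prod.lessThan_Suc_shift by (simp add: mult_ac)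

section \<open>Absolutely convergent sums over products\<close>

lemma abs_has_sum_times:
  fixes f :: "'a \<Rightarrow> complex" and g :: "'b \<Rightarrow> complex"
  assumes "(f has_sum a) A" "(\<lambda>x. norm (f x)) summable_on A"
    and "(g has_sum b) B" "(\<lambda>x. norm (g x)) summable_on B"
  shows "((\<lambda>z. f (fst z) * g (snd z)) has_sum (a * b)) (A \<times> B)"
    and "(\<lambda>z. norm (f (fst z) * g (snd z))) summable_on (A \<times> B)"
proof -
  show abs: "(\<lambda>z. norm (f (fst z) * g (snd z))) summable_on (A \<times> B)"
    using assms(2,4)
    by (subst Infinite_Sum.abs_summable_on_Sigma_iff)
       (auto simp: norm_mult infsum_cmult_right' abs_mult infsum_nonneg
             intro!: summable_on_cmult_right summable_on_cmult_left)
  show "((\<lambda>z. f (fst z) * g (snd z)) has_sum (a * b)) (A \<times> B)"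
  proof (rule has_sum_SigmaI)
    show "((\<lambda>y. f (fst (x, y)) * g (snd (x, y))) has_sum (f x * b)) B" for x
      using assms(3) by (simp add: has_sum_cmult_right)
    show "((\<lambda>x. f x * b) has_sum (a * b)) A"
      using assms(1) by (rule has_sum_cmult_left)
  qed (rule abs_summable_summable[OF abs])
qed

lemma has_sum_int_of_nat:
  fixes F :: "int \<Rightarrow> 'a :: {comm_monoid_add, topological_space}"
  assumes "((\<lambda>n::nat. F (int n)) has_sum s) UNIV" "\<And>k. k < 0 \<Longrightarrow> F k = 0"
  shows "(F has_sum s) UNIV"
proof -
  have "(F has_sum s) (range int)"
    using assms(1) by (subst has_sum_reindex) (auto simp: o_def)
  moreover have "k < 0" if "k \<notin> range int" for k
    using that by (metis nat_0_le not_le rangeI)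
  ultimately show ?thesis
    using assms(2) by (intro iffD1[OF has_sum_cong_neutral[of UNIV "range int" F F]]) blast+
qed

lemma has_sum_diff:
  fixes f g :: "'a \<Rightarrow> complex"
  assumes "(f has_sum a) A" "(g has_sum b) A"
  shows "((\<lambda>x. f x - g x) has_sum (a - b)) A"
  using has_sum_add[OF assms(1) has_sum_uminus[THEN iffD2], of g "- b"] assms(2) by simp

text \<open>
  Summation over one index of an absolutely convergent double series leaves an absolutely convergent
  series; the second claim is needed when the result is multiplied by further series.
\<close>

lemma has_sum_Sigma_abs:
  fixes f :: "'a \<times> 'b \<Rightarrow> complex"
  assumes "(f has_sum s) (A \<times> B)" "(\<lambda>z. norm (f z)) summable_on (A \<times> B)"
    and g: "\<And>x. x \<in> A \<Longrightarrow> ((\<lambda>y. f (x, y)) has_sum g x) B"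
  shows "(g has_sum s) A" "(\<lambda>x. norm (g x)) summable_on A"
proof -
  show "(g has_sum s) A"
    by (rule has_sum_SigmaD[OF assms(1) g])
  have 1: "(\<lambda>y. norm (f (x, y))) summable_on B" if "x \<in> A" for x
    using assms(2) that by (subst (asm) Infinite_Sum.abs_summable_on_Sigma_iff) auto
  have 2: "(\<lambda>x. norm (infsum (\<lambda>y. norm (f (x, y))) B)) summable_on A"
    using assms(2) by (subst (asm) Infinite_Sum.abs_summable_on_Sigma_iff) auto
  show "(\<lambda>x. norm (g x)) summable_on A"
  proof (rule Infinite_Sum.abs_summable_on_comparison_test'[OF 2])
    fix x assume x: "x \<in> A"
    have "norm (g x) \<le> infsum (\<lambda>y. norm (f (x, y))) B"
      using norm_infsum_bound[OF 1[OF x]] infsumI[OF g[OF x]] by simp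
    then show "norm (g x) \<le> norm (infsum (\<lambda>y. norm (f (x, y))) B)" by simp
  qed
qed

section \<open>Means over circles\<close>

text \<open>
  The centre is 0. The starting point \<open>R\<close> is complex rather than a positive radius because the substitution
  \<open>v = t w / \<tau>\<close> rotates the circle by the argument of \<open>t\<close>; the mean does not depend on that rotation, but
  allowing it makes the change of variables trivial.
\<close>

definition cmean :: "complex \<Rightarrow> (complex \<Rightarrow> complex) \<Rightarrow> complex" where
  "cmean R f = integral {-pi..pi} (\<lambda>\<eta>. f (R * exp (\<i> * of_real \<eta>))) / (2 * of_real pi)"

lemma exp_int_integral:
  "((\<lambda>\<eta>. exp (\<i> * of_real \<eta>) powi e) has_integral (if e = 0 then 2 * of_real pi else 0)) {-pi..pi}"
proof (cases "e = 0")
  case True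
  then show ?thesis using has_integral_const_real[of "1 :: complex" "-pi" pi]
    by (simp add: scaleR_conv_of_real)
next
  case False
  define F where "F \<eta> = exp (\<i> * of_int e * of_real \<eta>) / (\<i> * of_int e)" for \<eta> :: real
  have "((\<lambda>\<eta>. exp (\<i> * of_real \<eta>) powi e) has_integral (F pi - F (-pi))) {-pi..pi}"
  proof (rule fundamental_theorem_of_calculus)
    fix x :: real
    have "((\<lambda>\<eta>::complex. exp (\<i> * of_int e * \<eta>) / (\<i> * of_int e)) has_field_derivative
        exp (\<i> * of_int e * of_real x)) (at (of_real x))"
      using False by (auto intro!: derivative_eq_intros)
    then have "(F has_vector_derivative exp (\<i> * of_int e * of_real x)) (at x)"
      unfolding F_def by (rule has_vector_derivative_real_field)
    moreover have "exp (\<i> * of_int e * of_real x) = exp (\<i> * of_real x) powi e"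
      by (simp add: exp_power_int mult_ac)
    ultimately show "(F has_vector_derivative exp (\<i> * of_real x) powi e) (at x within {-pi..pi})"
      by (simp add: has_vector_derivative_at_within)
  qed simp
  moreover have "exp (\<i> * of_int e * of_real pi) = exp (\<i> * of_int e * of_real (-pi))"
    by (subst exp_eq) (auto intro!: exI[of _ e] simp: algebra_simps)
  ultimately show ?thesis using False by (simp add: F_def)
qed

text \<open>
  For an absolutely convergent Laurent expansion, indexed by an arbitrary set with exponents \<open>e\<close>, the mean
  may be taken termwise: the norms on the circle are constant, hence the convergence is uniform. Only
  the exponent 0 survives. The arbitrary index set permits products of several expansions without
  collecting equal powers first.
\<close>

theorem constant_term:
  fixes c :: "'i \<Rightarrow> complex" and e :: "'i \<Rightarrow> int"
  assumes r: "R \<noteq> 0"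
    and summ: "(\<lambda>i. norm (c i) * norm R powi e i) summable_on A"
    and f: "\<And>u. norm u = norm R \<Longrightarrow> ((\<lambda>i. c i * u powi e i) has_sum f u) A"
  shows "(c has_sum cmean R f) {i \<in> A. e i = 0}"
proof -
  define U where "U \<eta> = R * exp (\<i> * of_real \<eta>)" for \<eta> :: real
  have U: "norm (U \<eta>) = norm R" for \<eta> using r by (simp add: U_def norm_mult)
  have contU: "continuous_on {-pi..pi} (\<lambda>\<eta>. c i * U \<eta> powi e i)" for i
    using r unfolding U_def by (intro continuous_intros) auto
  have lim: "uniform_limit {-pi..pi} (\<lambda>X \<eta>. \<Sum>i\<in>X. c i * U \<eta> powi e i) (\<lambda>\<eta>. f (U \<eta>)) (finite_subsets_at_top A)"
    by (rule Weierstrass_m_test_general'[OF _ f[OF U] summ])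
       (simp add: norm_mult norm_power_int U)
  obtain I J where I: "\<And>X. ((\<lambda>\<eta>. \<Sum>i\<in>X. c i * U \<eta> powi e i) has_integral I X) {-pi..pi}"
    and J: "((\<lambda>\<eta>. f (U \<eta>)) has_integral J) {-pi..pi}"
    and IJ: "(I \<longlongrightarrow> J) (finite_subsets_at_top A)"
    by (rule uniform_limit_integral[OF lim]) (auto intro!: continuous_intros contU)
  have summand: "((\<lambda>\<eta>. c i * U \<eta> powi e i) has_integral (c i * (if e i = 0 then 2 * of_real pi else 0))) {-pi..pi}" for i
  proof -
    have "((\<lambda>\<eta>. (c i * R powi e i) * exp (\<i> * of_real \<eta>) powi e i) has_integral
        ((c i * R powi e i) * (if e i = 0 then 2 * of_real pi else 0))) {-pi..pi}"
      by (intro has_integral_mult_right exp_int_integral)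
    then show ?thesis by (auto simp: U_def power_int_mult_distrib mult_ac)
  qed
  have "I X = (\<Sum>i\<in>X. c i * (if e i = 0 then 2 * of_real pi else 0))" if "finite X" for X
    using that by (intro has_integral_unique[OF I] has_integral_sum summand)
  then have "((\<lambda>X. \<Sum>i\<in>X. c i * (if e i = 0 then 2 * of_real pi else 0)) \<longlongrightarrow> J) (finite_subsets_at_top A)"
    by (intro Lim_transform_eventually[OF IJ] eventually_finite_subsets_at_top_weakI) auto
  then have "((\<lambda>i. c i * (if e i = 0 then 2 * of_real pi else 0)) has_sum J) A"
    by (simp add: has_sum_def)
  then have "((\<lambda>i. (c i * (if e i = 0 then 2 * of_real pi else 0)) * (1 / (2 * of_real pi))) has_sum
      (J * (1 / (2 * of_real pi)))) A"
    by (rule has_sum_cmult_left)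
  then have "((\<lambda>i. (c i * (if e i = 0 then 2 * of_real pi else 0)) * (1 / (2 * of_real pi))) has_sum
      cmean R f) A"
    using integral_unique[OF J] by (simp add: cmean_def U_def)
  then show ?thesis
    by (rule iffD1[OF has_sum_cong_neutral, rotated -1]) auto
qed

lemma cmean_has_integral:
  assumes "continuous_on (sphere 0 (norm R)) f"
  shows "((\<lambda>\<eta>. f (R * exp (\<i> * of_real \<eta>))) has_integral (2 * of_real pi * cmean R f)) {-pi..pi}"
proof -
  have "continuous_on {-pi..pi} (\<lambda>\<eta>. f (R * exp (\<i> * of_real \<eta>)))"
    by (rule continuous_on_compose2[OF assms]) (auto intro!: continuous_intros simp: norm_mult)
  then show ?thesis
    by (simp add: cmean_def integrable_continuous_real has_integral_integral[symmetric])
qed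

lemma continuous_on_sphere_bounded:
  fixes f :: "complex \<Rightarrow> complex"
  assumes "continuous_on (sphere 0 r) f"
  obtains K where "K > 0" "\<And>u. norm u = r \<Longrightarrow> norm (f u) \<le> K"
proof -
  have "bounded (f ` sphere 0 r)"
    by (intro compact_imp_bounded compact_continuous_image assms) auto
  then show ?thesis using that by (auto simp: bounded_pos)
qed

lemma cmean_eqI:
  assumes "((\<lambda>\<eta>. f (R * exp (\<i> * of_real \<eta>))) has_integral (2 * of_real pi * I)) {-pi..pi}"
  shows "cmean R f = I"
  using integral_unique[OF assms] by (simp add: cmean_def)

lemma cmean_cong: "(\<And>u. norm u = norm R \<Longrightarrow> f u = g u) \<Longrightarrow> cmean R f = cmean R g"
  unfolding cmean_def by (intro arg_cong2[of _ _ _ _ "(/)"] integral_cong refl) (simp add: norm_mult)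

lemma cmean_cmult: "cmean R (\<lambda>u. c * f u) = c * cmean R f"
  by (simp add: cmean_def)

lemma cmean_diff:
  assumes "continuous_on (sphere 0 (norm R)) f" "continuous_on (sphere 0 (norm R)) g"
  shows "cmean R (\<lambda>u. f u - g u) = cmean R f - cmean R g"
  using has_integral_diff[OF assms[THEN cmean_has_integral]]
  by (intro cmean_eqI) (simp add: algebra_simps)

lemma cmean_sum:
  assumes "finite I" "\<And>i. i \<in> I \<Longrightarrow> continuous_on (sphere 0 (norm R)) (f i)"
  shows "cmean R (\<lambda>u. \<Sum>i\<in>I. f i u) = (\<Sum>i\<in>I. cmean R (f i))"
  using has_integral_sum[OF assms(1) cmean_has_integral[OF assms(2)]]
  by (intro cmean_eqI) (simp add: sum_distrib_left)

lemma cmean_sums: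
  assumes cont: "\<And>n. continuous_on (sphere 0 (norm R)) (f n)"
    and bound: "\<And>n u. norm u = norm R \<Longrightarrow> norm (f n u) \<le> M n" and M: "summable M"
    and g: "\<And>u. norm u = norm R \<Longrightarrow> (\<lambda>n. f n u) sums g u"
  shows "(\<lambda>n. cmean R (f n)) sums cmean R g"
proof -
  define U where "U \<eta> = R * exp (\<i> * of_real \<eta>)" for \<eta> :: real
  have U: "norm (U \<eta>) = norm R" for \<eta> by (simp add: U_def norm_mult)
  have contU: "continuous_on {-pi..pi} (\<lambda>\<eta>. f n (U \<eta>))" for n
    by (rule continuous_on_compose2[OF cont]) (auto intro!: continuous_intros simp: U_def norm_mult)
  have "uniform_limit {-pi..pi} (\<lambda>n \<eta>. \<Sum>i<n. f i (U \<eta>)) (\<lambda>\<eta>. \<Sum>i. f i (U \<eta>)) sequentially"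
    by (rule Weierstrass_m_test[OF bound M]) (rule U)
  moreover have "(\<Sum>i. f i (U \<eta>)) = g (U \<eta>)" for \<eta>
    using g[OF U] by (rule sums_unique[symmetric])
  ultimately have lim: "uniform_limit {-pi..pi} (\<lambda>n \<eta>. \<Sum>i<n. f i (U \<eta>)) (\<lambda>\<eta>. g (U \<eta>)) sequentially"
    by simp
  obtain I J where I: "\<And>n. ((\<lambda>\<eta>. \<Sum>i<n. f i (U \<eta>)) has_integral I n) {-pi..pi}"
    and J: "((\<lambda>\<eta>. g (U \<eta>)) has_integral J) {-pi..pi}" and IJ: "I \<longlonglongrightarrow> J"
    by (rule uniform_limit_integral[OF lim]) (auto intro!: continuous_intros contU)
  have "I n = (\<Sum>i<n. 2 * of_real pi * cmean R (f i))" for n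
    using cmean_has_integral[OF cont] unfolding U_def[symmetric]
    by (intro has_integral_unique[OF I] has_integral_sum) auto
  then have "I = (\<lambda>n. \<Sum>i<n. 2 * of_real pi * cmean R (f i))" by (rule ext)
  then have "(\<lambda>i. 2 * of_real pi * cmean R (f i)) sums J"
    using IJ by (simp only: sums_def)
  then have "(\<lambda>i. 2 * of_real pi * cmean R (f i) / (2 * of_real pi)) sums (J / (2 * of_real pi))"
    by (rule sums_divide)
  moreover have "J / (2 * of_real pi) = cmean R g"
    using J by (simp add: cmean_def U_def integral_unique)
  ultimately show ?thesis by simp
qed

section \<open>The Durfee rectangle identity and the triple product\<close>

text \<open>
  Reciprocal q-factorials with the convention that they vanish at negative indices. Sums over
  \<open>\<nat>\<close> with shifted indices then become sums over all integers, and changes of summation variables are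
  bijections of \<open>\<int>\<^sup>n\<close> without boundary conditions.
\<close>

definition rfac :: "complex \<Rightarrow> int \<Rightarrow> complex" where
  "rfac q k = (if k < 0 then 0 else 1 / qfac q q (nat k))"

definition durfee :: "complex \<Rightarrow> int \<Rightarrow> int \<Rightarrow> complex" where
  "durfee q k n = rfac q n * rfac q (n + k) * q powi (n * (n + k))"

definition durfee_sum :: "complex \<Rightarrow> int \<Rightarrow> complex" where
  "durfee_sum q k = (\<Sum>\<^sub>\<infinity>n. durfee q k n)"

definition tri :: "int \<Rightarrow> int" where
  "tri k = k * (k - 1) div 2"

lemma two_tri: "2 * tri k = k * (k - 1)"
  unfolding tri_def by (rule dvd_mult_div_cancel) auto

lemma tri_int: "tri (int n) = int (n * (n - 1) div 2)"
proof -
  have "int n * (int n - 1) = int (n * (n - 1))"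
    by (cases n) (auto simp: algebra_simps)
  then show ?thesis unfolding tri_def by (simp only: zdiv_int of_nat_numeral)
qed

context
  fixes q :: complex
  assumes q1: "norm q < 1" and q0: "q \<noteq> 0"
begin

lemma rfac_neg [simp]: "k < 0 \<Longrightarrow> rfac q k = 0"
  by (simp add: rfac_def)

lemma rfac_int: "rfac q (int n) = 1 / qfac q q n"
  by (simp add: rfac_def)

lemma rfac_step: "(1 - q powi k) * rfac q k = rfac q (k - 1)"
proof (cases "k \<le> 0")
  case True
  then show ?thesis by (cases "k = 0") (auto simp: rfac_def)
next
  case False
  then obtain n where n: "k = int (Suc n)"
    by (metis not_le zero_less_imp_eq_int Suc_pred)
  have "k - 1 = int n" using n by simp
  then show ?thesis
    using qfac_q_nonzero[OF q1, of "Suc n"]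
    by (simp only: n rfac_int power_int_of_nat qfac_Suc) (auto simp: rfac_int divide_simps)
qed

lemma rfac_bound: obtains B where "B > 0" "\<And>k. norm (rfac q k) \<le> B"
proof -
  obtain B where "B > 0" "\<And>n. norm (1 / qfac q q n) \<le> B"
    using inverse_qfac_bounded[OF q1, of q] mult_power_ne_1[OF q1] q1 by metis
  then show ?thesis using that[of B] by (auto simp: rfac_def less_imp_le)
qed

lemma rfac_tendsto: "(\<lambda>n. rfac q (int n)) \<longlonglongrightarrow> 1 / qinf q q"
  unfolding rfac_int by (intro tendsto_intros qfac_tendsto_qinf q1 qinf_nonzero)

lemma durfee_bound:
  assumes B: "\<And>k. norm (rfac q k) \<le> B" and c: "n \<ge> 0 \<Longrightarrow> n + k \<ge> 0 \<Longrightarrow> c \<le> n * (n + k)"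
  shows "norm (durfee q k n) \<le> B\<^sup>2 * norm q powi c"
proof (cases "n \<ge> 0 \<and> n + k \<ge> 0")
  case True
  have "norm (durfee q k n) = norm (rfac q n) * norm (rfac q (n + k)) * norm q powi (n * (n + k))"
    by (simp add: durfee_def norm_mult norm_power_int)
  also have "\<dots> \<le> B * B * norm q powi c"
    using B[of 0] c True q1 q0
    by (intro mult_mono B power_int_decreasing) (auto intro: order_trans[OF norm_ge_zero B])
  finally show ?thesis by (simp add: power2_eq_square)
next
  case False
  then have "durfee q k n = 0" by (auto simp: durfee_def not_le)
  then show ?thesis by simp
qed

lemma geometric_int_summable:
  "(\<lambda>n::int. if n \<ge> 0 then C * norm q powi (n + d) else 0) summable_on UNIV"
proof -
  have "(\<lambda>n::nat. C * norm q powi d * norm q ^ n) summable_on UNIV"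
    using q1 by (intro norm_summable_imp_summable_on)
       (simp add: summable_mult summable_geometric abs_mult power_abs)
  then have "((\<lambda>n::nat. if int n \<ge> 0 then C * norm q powi (int n + d) else 0) has_sum
      (\<Sum>\<^sub>\<infinity>n::nat. C * norm q powi d * norm q ^ n)) UNIV"
    using q0 by (simp add: power_int_add mult_ac)
  from has_sum_int_of_nat[where F = "\<lambda>n. if n \<ge> 0 then C * norm q powi (n + d) else 0", OF this]
  show ?thesis by (auto simp: summable_on_def)
qed

lemma durfee_exponent: "n \<ge> 0 \<Longrightarrow> n + k \<ge> 0 \<Longrightarrow> n - \<bar>k\<bar> \<le> n * (n + k)" for n k :: int
proof -
  assume n: "n \<ge> 0" "n + k \<ge> 0"
  show ?thesis
  proof (cases "n + k = 0")
    case False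
    then have "n * 1 \<le> n * (n + k)" using n by (intro mult_left_mono) auto
    then show ?thesis by simp
  qed (use n in auto)
qed

lemma durfee_abs_summable: "(\<lambda>n. norm (durfee q k n)) summable_on UNIV"
proof -
  obtain B where B: "\<And>k. norm (rfac q k) \<le> B" using rfac_bound by metis
  have "norm (durfee q k n) \<le> (if n \<ge> 0 then B\<^sup>2 * norm q powi (n + (- \<bar>k\<bar>)) else 0)" for n
    using durfee_bound[OF B, of n k "n - \<bar>k\<bar>"] durfee_exponent[of n k]
    by (auto simp: durfee_def)
  then show ?thesis
    by (intro Infinite_Sum.abs_summable_on_comparison_test'[OF geometric_int_summable])
qed

lemma durfee_has_sum: "(durfee q k has_sum durfee_sum q k) UNIV"
  unfolding durfee_sum_def by (rule has_sum_infsum, rule abs_summable_summable, rule durfee_abs_summable)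

text \<open>
  The recurrence \<open>rfac_step\<close>, applied to each of the two reciprocal factorials, writes the difference of the
  summands as a multiple of a shifted difference. It holds for negative \<open>k\<close> as well, because \<open>rfac\<close>
  satisfies its recurrence at every integer.
\<close>

lemma durfee_step:
  "durfee_sum q k - durfee_sum q (k + 1) = - (q powi (k + 1)) * (durfee_sum q (k + 1) - durfee_sum q (k + 2))"
proof -
  have "durfee q k n - durfee q (k + 1) n =
      q powi (k + 1) * durfee q (k + 2) (n - 1) - q powi (k + 1) * durfee q (k + 1) n" for n
  proof -
    have 1: "durfee q k n = rfac q n * rfac q (n + k + 1) * (1 - q powi (n + k + 1)) * q powi (n * (n + k))"
      using rfac_step[of "n + k + 1"] by (simp add: durfee_def mult_ac)
    have 2: "durfee q (k + 1) n = rfac q n * rfac q (n + k + 1) * (q powi (n * (n + k)) * q powi n)"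
      using q0 by (simp add: durfee_def distrib_left add.assoc flip: power_int_add)
    have 3: "q powi (k + 1) * durfee q (k + 2) (n - 1) =
        ((1 - q powi n) * rfac q n) * rfac q (n + k + 1) * q powi (n * (n + k))"
    proof -
      have e: "k + 1 + (n - 1) * (n - 1 + (k + 2)) = n * (n + k)" by (simp add: algebra_simps)
      have "q powi (k + 1) * q powi ((n - 1) * (n - 1 + (k + 2))) = q powi (n * (n + k))"
        using q0 e by (metis power_int_add)
      then show ?thesis unfolding rfac_step by (simp add: durfee_def algebra_simps)
    qed
    have 4: "q powi (n + k + 1) = q powi (k + 1) * q powi n"
      using q0 by (simp add: add_ac flip: power_int_add)
    show ?thesis unfolding 1 2 3 4 by (simp add: algebra_simps)
  qed
  moreover have "((\<lambda>n. durfee q k n - durfee q (k + 1) n) has_sum (durfee_sum q k - durfee_sum q (k + 1))) UNIV"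
    by (intro has_sum_diff durfee_has_sum)
  moreover have "((\<lambda>n. q powi (k + 1) * durfee q (k + 2) (n - 1) - q powi (k + 1) * durfee q (k + 1) n) has_sum
      (q powi (k + 1) * durfee_sum q (k + 2) - q powi (k + 1) * durfee_sum q (k + 1))) UNIV"
  proof (intro has_sum_diff has_sum_cmult_right durfee_has_sum)
    show "((\<lambda>n. durfee q (k + 2) (n - 1)) has_sum durfee_sum q (k + 2)) UNIV"
      by (rule iffD2[OF has_sum_reindex_bij_witness[of UNIV "\<lambda>n. n + 1" "\<lambda>n. n - 1" UNIV "durfee q (k + 2)"]
            durfee_has_sum[of "k + 2"]]) auto
  qed
  ultimately have "durfee_sum q k - durfee_sum q (k + 1) =
      q powi (k + 1) * durfee_sum q (k + 2) - q powi (k + 1) * durfee_sum q (k + 1)"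
    by (metis (no_types, lifting) has_sum_cong has_sum_unique)
  then show ?thesis by (simp add: algebra_simps)
qed

text \<open>
  For \<open>k \<ge> 0\<close> every summand except that of \<open>n = 0\<close> contains the factor \<open>q\<^sup>k\<close>.
\<close>

lemma durfee_sum_bound:
  obtains C where "\<And>k. k \<ge> 0 \<Longrightarrow> norm (durfee_sum q k - rfac q k) \<le> C * norm q powi k"
proof -
  obtain B where B: "\<And>k. norm (rfac q k) \<le> B" using rfac_bound by metis
  define M where "M n = (if n \<ge> 0 then B\<^sup>2 * norm q powi (n + 0) else 0)" for n :: int
  define C where "C = infsum M UNIV"
  have M: "M summable_on UNIV" unfolding M_def by (rule geometric_int_summable)
  have "norm (durfee_sum q k - rfac q k) \<le> C * norm q powi k" if k: "k \<ge> 0" for k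
  proof -
    have "(durfee q k has_sum (durfee_sum q k - durfee q k 0)) (UNIV - {0})"
      by (rule has_sum_Diff[OF durfee_has_sum has_sum_finiteI]) auto
    moreover have "durfee q k 0 = rfac q k"
      using rfac_int[of 0] by (simp add: durfee_def)
    ultimately have *: "((\<lambda>n. if n = 0 then 0 else durfee q k n) has_sum (durfee_sum q k - rfac q k)) UNIV"
      by (intro iffD1[OF has_sum_cong_neutral[of UNIV "UNIV - {0}" _ "durfee q k"]]) auto
    have "norm (durfee_sum q k - rfac q k) \<le> infsum (\<lambda>n. M n * norm q powi k) UNIV"
    proof (rule norm_infsum_le[OF *])
      show "((\<lambda>n. M n * norm q powi k) has_sum infsum (\<lambda>n. M n * norm q powi k) UNIV) UNIV"
        by (intro has_sum_infsum summable_on_cmult_left M)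
      fix n :: int
      show "norm (if n = 0 then 0 else durfee q k n) \<le> M n * norm q powi k"
      proof (cases "n \<ge> 1")
        case True
        then have "1 * (n + k) \<le> n * (n + k)" using k by (intro mult_right_mono) auto
        then have "norm (durfee q k n) \<le> B\<^sup>2 * norm q powi (n + k)"
          by (intro durfee_bound[OF B]) auto
        then show ?thesis using True q0 by (simp add: M_def power_int_add mult.assoc)
      next
        case False
        then show ?thesis by (cases "n = 0") (auto simp: M_def durfee_def)
      qed
    qed
    also have "\<dots> = C * norm q powi k" by (simp add: C_def infsum_cmult_left')
    finally show ?thesis .
  qed
  then show ?thesis using that by blast
qed

lemma durfee_sum_tendsto: "(\<lambda>n. durfee_sum q (int n)) \<longlonglongrightarrow> 1 / qinf q q"
proof -
  obtain C where C: "\<And>k. k \<ge> 0 \<Longrightarrow> norm (durfee_sum q k - rfac q k) \<le> C * norm q powi k"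
    using durfee_sum_bound by metis
  have lim: "(\<lambda>n. C * norm q ^ n) \<longlonglongrightarrow> 0"
    using tendsto_mult_left[OF LIMSEQ_power_zero[of "norm q"], of C] q1 by simp
  have "(\<lambda>n. durfee_sum q (int n) - rfac q (int n)) \<longlonglongrightarrow> 0"
  proof (rule Lim_null_comparison[OF always_eventually lim], rule allI)
    fix n
    show "norm (durfee_sum q (int n) - rfac q (int n)) \<le> C * norm q ^ n"
      using C[of "int n"] by simp
  qed
  from tendsto_add[OF this rfac_tendsto] show ?thesis by simp
qed

text \<open>
  The differences \<open>\<delta> k\<close> satisfy \<open>\<delta> k = - q\<^bsup>k+1\<^esup> \<delta> (k+1)\<close>. Upwards this makes their norms increasing while they
  tend to 0, so they vanish for \<open>k \<ge> 0\<close>; downwards it then propagates the zero to negative \<open>k\<close>.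
\<close>

lemma durfee_sum_const: "durfee_sum q k = durfee_sum q (k + 1)"
proof -
  define \<delta> where "\<delta> k = durfee_sum q k - durfee_sum q (k + 1)" for k
  have step: "\<delta> k = - (q powi (k + 1)) * \<delta> (k + 1)" for k
    using durfee_step[of k] by (simp add: \<delta>_def algebra_simps)
  have lim': "(\<lambda>n. norm (\<delta> (int n))) \<longlonglongrightarrow> 0"
  proof -
    have "(\<lambda>n. \<delta> (int n)) \<longlonglongrightarrow> 1 / qinf q q - 1 / qinf q q"
      unfolding \<delta>_def using durfee_sum_tendsto LIMSEQ_Suc[OF durfee_sum_tendsto] by (intro tendsto_diff) (simp_all add: add.commute)
    then show ?thesis by (simp add: tendsto_norm_zero)
  qed
  have "incseq (\<lambda>n. norm (\<delta> (int n)))"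
  proof (rule incseq_SucI)
    fix n
    have "norm (\<delta> (int n)) = norm q ^ Suc n * norm (\<delta> (int (Suc n)))"
      using step[of "int n"] by (simp add: norm_mult norm_power_int add.commute flip: power_int_of_nat)
    also have "\<dots> \<le> 1 * norm (\<delta> (int (Suc n)))"
      using q1 by (intro mult_right_mono power_le_one) auto
    finally show "norm (\<delta> (int n)) \<le> norm (\<delta> (int (Suc n)))" by simp
  qed
  from incseq_le[OF this lim'] have nonneg: "\<delta> (int n) = 0" for n by simp
  have "\<delta> (- int n) = 0" for n
  proof (induction n)
    case (Suc n)
    then show ?case using step[of "- int (Suc n)"] by simp
  qed (use nonneg[of 0] in simp)
  then have "\<delta> k = 0"
    using nonneg by (metis int_cases2)
  then show ?thesis by (simp add: \<delta>_def)
qed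

text \<open>
  The sum does not depend on \<open>k\<close>, and for \<open>k \<rightarrow> \<infinity>\<close> only the summand \<open>rfac k\<close> of \<open>n = 0\<close> remains.
\<close>

lemma durfee_identity: "(durfee q k has_sum (1 / qinf q q)) UNIV"
proof -
  have pos: "durfee_sum q (int n) = durfee_sum q 0" for n
  proof (induction n)
    case (Suc n)
    then show ?case using durfee_sum_const[of "int n"] by (simp add: add.commute)
  qed simp
  have neg: "durfee_sum q (- int n) = durfee_sum q 0" for n
  proof (induction n)
    case (Suc n)
    then show ?case using durfee_sum_const[of "- int (Suc n)"] by simp
  qed simp
  from pos neg have const: "durfee_sum q j = durfee_sum q 0" for j
    by (metis int_cases2)
  have "durfee_sum q k = durfee_sum q 0" by (rule const)
  also have "\<dots> = 1 / qinf q q"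
    by (rule LIMSEQ_unique[of "\<lambda>n. durfee_sum q (int n)"]) (simp only: pos tendsto_const, rule durfee_sum_tendsto)
  finally show ?thesis using durfee_has_sum[of k] by simp
qed

lemma euler_int:
  shows "((\<lambda>m. rfac q m * (q powi tri m * (- z) powi m)) has_sum qinf q z) UNIV"
    and "(\<lambda>m. norm (rfac q m * (q powi tri m * (- z) powi m))) summable_on UNIV"
proof -
  have eq: "rfac q (int n) * (q powi tri (int n) * (- z) powi int n) = hfac q 0 z n / qfac q q n" for n
    unfolding rfac_int tri_int power_int_of_nat hfac_zero_eq[OF q1] by simp
  have abs: "summable (\<lambda>n. norm (hfac q 0 z n / qfac q q n))"
    by (rule qbinomial_abs_summable[OF q1]) simp
  show "((\<lambda>m. rfac q m * (q powi tri m * (- z) powi m)) has_sum qinf q z) UNIV"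
    by (rule has_sum_int_of_nat, unfold eq)
       (auto intro: norm_summable_imp_has_sum[OF abs euler_series[OF q1]] simp: rfac_def)
  have "summable (\<lambda>n. norm (norm (hfac q 0 z n / qfac q q n)))" using abs by simp
  from norm_summable_imp_summable_on[OF this] 
  have "((\<lambda>n. norm (rfac q (int n) * (q powi tri (int n) * (- z) powi int n))) has_sum 
     infsum (\<lambda>n. norm (hfac q 0 z n / qfac q q n)) UNIV) UNIV"
    unfolding eq by (rule has_sum_infsum)
  from has_sum_int_of_nat[OF this] 
  show "(\<lambda>m. norm (rfac q m * (q powi tri m * (- z) powi m))) summable_on UNIV"
    by (auto simp: summable_on_def rfac_def)
qed

lemma euler_recip_int:
  assumes z: "norm z < 1"
  shows "((\<lambda>m. rfac q m * z powi m) has_sum (1 / qinf q z)) UNIV"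
    and "(\<lambda>m. norm (rfac q m * z powi m)) summable_on UNIV"
proof -
  have eq: "rfac q (int n) * z powi int n = hfac q z 0 n / qfac q q n" for n
    unfolding rfac_int power_int_of_nat hfac_alpha_zero by simp
  have abs: "summable (\<lambda>n. norm (hfac q z 0 n / qfac q q n))"
    by (rule qbinomial_abs_summable[OF q1 z])
  have "(\<lambda>n. hfac q z 0 n / qfac q q n) sums (1 / qinf q z)"
    using qbinomial[OF q1 z, of 0] q1 by simp
  then show "((\<lambda>m. rfac q m * z powi m) has_sum (1 / qinf q z)) UNIV"
    by (intro has_sum_int_of_nat, unfold eq)
       (auto intro: norm_summable_imp_has_sum[OF abs] simp: rfac_def)
  have "summable (\<lambda>n. norm (norm (hfac q z 0 n / qfac q q n)))" using abs by simp
  from norm_summable_imp_summable_on[OF this]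
  have "((\<lambda>n. norm (rfac q (int n) * z powi int n)) has_sum
     infsum (\<lambda>n. norm (hfac q z 0 n / qfac q q n)) UNIV) UNIV"
    unfolding eq by (rule has_sum_infsum)
  from has_sum_int_of_nat[OF this]
  show "(\<lambda>m. norm (rfac q m * z powi m)) summable_on UNIV"
    by (auto simp: summable_on_def rfac_def)
qed

text \<open>
  Multiply Euler's series for \<open>(z; q)\<close> and \<open>(q/z; q)\<close> and collect the powers of \<open>z\<close>: the coefficient of \<open>z\<^sup>k\<close>
  is a Durfee sum.
\<close>

theorem jacobi_triple_product:
  assumes z: "z \<noteq> 0"
  shows "((\<lambda>k. (- z) powi k * q powi tri k) has_sum (theta q z * qinf q q)) UNIV"
    and "(\<lambda>k. norm ((- z) powi k * q powi tri k)) summable_on UNIV"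
proof -
  define F where "F x = rfac q (fst x) * (q powi tri (fst x) * (- z) powi fst x) *
     (rfac q (snd x) * (q powi tri (snd x) * (- (q / z)) powi snd x))" for x
  define G where "G k = ((- z) powi k * q powi tri k) * (1 / qinf q q)" for k
  have F: "(F has_sum theta q z) (UNIV \<times> UNIV)" "(\<lambda>x. norm (F x)) summable_on (UNIV \<times> UNIV)"
    unfolding F_def theta_def by (rule abs_has_sum_times euler_int)+
  have shift: "F (n + k, n) = ((- z) powi k * q powi tri k) * durfee q k n" for k n
  proof -
    have "2 * (tri (n + k) + tri n + n) = 2 * (tri k + n * (n + k))"
      unfolding distrib_left two_tri by (simp add: algebra_simps)
    then have "tri (n + k) + tri n + n = tri k + n * (n + k)" by (subst (asm) mult_cancel_left) simp
    then have e: "q powi tri (n + k) * q powi tri n * q powi n = q powi tri k * q powi (n * (n + k))"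
      using q0 by (simp flip: power_int_add)
    have "(- z) powi (n + k) * (- (q / z)) powi n = (- z) powi k * q powi n"
      using z by (simp add: power_int_add power_int_divide_distrib power_int_minus_left)
    with e show ?thesis
      unfolding F_def durfee_def fst_conv snd_conv by algebra
  qed
  \<comment> \<open>Collecting the power \<open>z\<^sup>k\<close>: the index pair is \<open>(n + k, n)\<close>.\<close>
  have "((\<lambda>x. F (snd x + fst x, snd x)) has_sum theta q z) (UNIV \<times> UNIV) \<longleftrightarrow> (F has_sum theta q z) (UNIV \<times> UNIV)"
    by (rule has_sum_reindex_bij_witness[of _ "\<lambda>x. (fst x - snd x, snd x)" "\<lambda>x. (snd x + fst x, snd x)"]) auto
  moreover have "(\<lambda>x. norm (F (snd x + fst x, snd x))) summable_on (UNIV \<times> UNIV) \<longleftrightarrow> (\<lambda>x. norm (F x)) summable_on (UNIV \<times> UNIV)"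
    by (rule summable_on_reindex_bij_witness[of _ "\<lambda>x. (fst x - snd x, snd x)" "\<lambda>x. (snd x + fst x, snd x)"]) auto
  ultimately have *: "((\<lambda>x. F (snd x + fst x, snd x)) has_sum theta q z) (UNIV \<times> UNIV)"
    "(\<lambda>x. norm (F (snd x + fst x, snd x))) summable_on (UNIV \<times> UNIV)" using F by auto
  have inner: "((\<lambda>n. F (snd (k, n) + fst (k, n), snd (k, n))) has_sum G k) UNIV" for k
    unfolding fst_conv snd_conv shift G_def
    by (intro has_sum_cmult_right durfee_identity q1 q0)
  note G = has_sum_Sigma_abs[OF * inner]
  have nz: "qinf q q \<noteq> 0" using q1 by (rule qinf_nonzero) (rule q1)
  from has_sum_cmult_left[OF G(1), of "qinf q q"]
  show "((\<lambda>k. (- z) powi k * q powi tri k) has_sum (theta q z * qinf q q)) UNIV"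
    using nz by (simp add: G_def)
  from summable_on_cmult_left[OF G(2), of "norm (qinf q q)"]
  show "(\<lambda>k. norm ((- z) powi k * q powi tri k)) summable_on UNIV"
    using nz by (simp add: G_def norm_mult norm_divide)
qed

end

section \<open>Moments of the theta kernel\<close>

definition qbin :: "complex \<Rightarrow> nat \<Rightarrow> nat \<Rightarrow> complex" where
  "qbin q N k = (if k \<le> N then qfac q q N / (qfac q q k * qfac q q (N - k)) else 0)"

definition rogers_szego :: "complex \<Rightarrow> nat \<Rightarrow> complex \<Rightarrow> complex" where
  "rogers_szego q N p = (\<Sum>k\<le>N. qbin q N k * p ^ k)"

text \<open>
  The part of the integrand that carries the free parameter \<open>h\<close>. Apart from 0 its singularities lie among the points
  \<open>p q\<^sup>n\<close> and \<open>q\<^sup>n\<close>, so all circles below have radius greater than 1 and \<open>norm p\<close>.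
\<close>

definition kern :: "complex \<Rightarrow> complex \<Rightarrow> complex \<Rightarrow> complex \<Rightarrow> complex" where
  "kern q h p u = theta q (h * u) * theta q (h * p / u) / (qinf q (p / u) * qinf q (1 / u))"

context
  fixes q :: complex
  assumes q1: "norm q < 1" and q0: "q \<noteq> 0"
begin

text \<open>
  Expand the two theta functions by the triple product (indices \<open>i, j\<close>) and the two reciprocals by Euler's
  series (indices \<open>\<alpha>, \<beta>\<close>). The constant term is the sum over \<open>i - j = \<alpha> + \<beta>\<close>. Replacing \<open>i, j\<close> by
  \<open>i + \<alpha>, j - \<alpha>\<close> leaves \<open>\<beta> = i - j + \<alpha>\<close> and turns the quadratic exponent into that of
  \<open>theta h theta (h p)\<close> plus \<open>\<alpha> (\<alpha> + i - j)\<close>, so that the sum over \<open>\<alpha>\<close> is a Durfee sum.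
\<close>

theorem theta_kernel_mean:
  assumes h: "h \<noteq> 0" and p: "p \<noteq> 0" and r: "norm R > 1" "norm R > norm p"
  shows "cmean R (kern q h p) = theta q h * theta q (h * p) / qinf q q"
proof -
  define T where "T z k = (- z) powi k * q powi tri k" for z k
  define f where "f = kern q h p"
  \<comment> \<open>The index is \<open>((i, j), (\<alpha>, \<beta>))\<close>; coefficient and exponent of \<open>u\<close> are \<open>c\<close> and \<open>e\<close>.\<close>
  define c where "c x = (T h (fst (fst x)) * T (h * p) (snd (fst x))) *
     ((rfac q (fst (snd x)) * p powi fst (snd x)) * rfac q (snd (snd x)))" for x :: "(int \<times> int) \<times> int \<times> int"
  define e where "e x = fst (fst x) - snd (fst x) - fst (snd x) - snd (snd x)"
    for x :: "(int \<times> int) \<times> int \<times> int"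
  define Q where "Q = qinf q q"
  have Q: "Q \<noteq> 0" unfolding Q_def using q1 by (rule qinf_nonzero) (rule q1)
  define P where "P u x = (T (h * u) (fst (fst x)) * T (h * p / u) (snd (fst x))) *
     ((rfac q (fst (snd x)) * (p / u) powi fst (snd x)) * (rfac q (snd (snd x)) * (1 / u) powi snd (snd x)))"
    for u and x :: "(int \<times> int) \<times> int \<times> int"
  have P: "(P u has_sum (Q\<^sup>2 * f u)) ((UNIV \<times> UNIV) \<times> UNIV \<times> UNIV)"
     "(\<lambda>x. norm (P u x)) summable_on ((UNIV \<times> UNIV) \<times> UNIV \<times> UNIV)" if u: "norm u = norm R" for u
  proof -
    have nz: "u \<noteq> 0" "norm (p / u) < 1" "norm (1 / u) < 1"
      using u r by (auto simp: norm_divide divide_less_eq_1)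
    have nz': "h * u \<noteq> 0" "h * p / u \<noteq> 0" using nz h p by auto
    note theta = abs_has_sum_times[OF jacobi_triple_product[OF q1 q0 nz'(1)] jacobi_triple_product[OF q1 q0 nz'(2)]]
    note recip = abs_has_sum_times[OF euler_recip_int[OF q1 q0 nz(2)] euler_recip_int[OF q1 q0 nz(3)]]
    note all = abs_has_sum_times[OF theta recip]
    from all(1) show "(P u has_sum (Q\<^sup>2 * f u)) ((UNIV \<times> UNIV) \<times> UNIV \<times> UNIV)"
      unfolding P_def T_def f_def kern_def Q_def by (simp add: power2_eq_square mult_ac)
    from all(2) show "(\<lambda>x. norm (P u x)) summable_on ((UNIV \<times> UNIV) \<times> UNIV \<times> UNIV)"
      unfolding P_def T_def by simp
  qed
  have Pc: "P u x = c x * u powi e x" if u: "u \<noteq> 0" for u x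
  proof -
    obtain i j \<alpha> \<beta> where x: "x = ((i, j), \<alpha>, \<beta>)" by (metis prod.exhaust)
    have 1: "(- (h * u)) powi i = (- h) powi i * u powi i"
      by (metis minus_mult_left power_int_mult_distrib)
    have 2: "(- (h * p / u)) powi j = (- (h * p)) powi j * u powi (- j)"
      by (metis minus_divide_left power_int_divide_distrib power_int_minus divide_inverse)
    have 3: "(p / u) powi \<alpha> = p powi \<alpha> * u powi (- \<alpha>)" "(1 / u) powi \<beta> = u powi (- \<beta>)"
      by (simp_all only: power_int_divide_distrib power_int_minus) (simp_all add: divide_inverse)
    have 4: "u powi (i - j - \<alpha> - \<beta>) = u powi i * u powi (- j) * u powi (- \<alpha>) * u powi (- \<beta>)"
      using u by (simp flip: power_int_add)
    show ?thesis
      unfolding x P_def c_def e_def T_def fst_conv snd_conv 1 2 3 4 by (simp only: mult_ac)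
  qed
  have "(\<lambda>x. norm (P (R) x)) summable_on UNIV"
    using P(2)[of R] by simp
  moreover have "norm (P (R) x) = norm (c x) * norm R powi e x" for x
    using r by (subst Pc) (auto simp: norm_mult norm_power_int)
  ultimately have summ: "(\<lambda>x. norm (c x) * norm R powi e x) summable_on UNIV" by simp
  have "(c has_sum cmean R (\<lambda>u. Q\<^sup>2 * f u)) {x \<in> UNIV. e x = 0}"
  proof (rule constant_term[OF _ summ])
    fix u :: complex assume u: "norm u = norm R"
    then have "u \<noteq> 0" using r by auto
    then have "P u = (\<lambda>i. c i * u powi e i)" by (simp add: Pc fun_eq_iff)
    with P(1)[OF u] show "((\<lambda>i. c i * u powi e i) has_sum Q\<^sup>2 * f u) UNIV"
      by simp
  qed (use r in auto)
  also have "cmean R (\<lambda>u. Q\<^sup>2 * f u) = Q\<^sup>2 * cmean R f"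
    by (simp add: cmean_def)
  finally have c: "(c has_sum Q\<^sup>2 * cmean R f) {x. e x = 0}" by simp
  \<comment> \<open>The substitution \<open>((i, j), \<alpha>) \<mapsto> ((i + \<alpha>, j - \<alpha>), (\<alpha>, i - j + \<alpha>))\<close> parametrises the indices with \<open>e = 0\<close>.\<close>
  define d where "d y = c ((fst (fst y) + snd y, snd (fst y) - snd y), (snd y, fst (fst y) - snd (fst y) + snd y))"
    for y :: "(int \<times> int) \<times> int"
  have "(d has_sum Q\<^sup>2 * cmean R f) (UNIV \<times> UNIV) \<longleftrightarrow> (c has_sum Q\<^sup>2 * cmean R f) {x. e x = 0}"
    by (rule has_sum_reindex_bij_witness[of _
       "\<lambda>x. ((fst (fst x) - fst (snd x), snd (fst x) + fst (snd x)), fst (snd x))"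
       "\<lambda>y. ((fst (fst y) + snd y, snd (fst y) - snd y), (snd y, fst (fst y) - snd (fst y) + snd y))"])
       (auto simp: d_def e_def)
  with c have d: "(d has_sum Q\<^sup>2 * cmean R f) (UNIV \<times> UNIV)" by simp
  have d_eq: "d (ij, \<alpha>) = T h (fst ij) * T (h * p) (snd ij) * durfee q (fst ij - snd ij) \<alpha>" for ij \<alpha>
  proof -
    obtain i j where ij: "ij = (i, j)" by (metis prod.exhaust)
    have "2 * (tri (i + \<alpha>) + tri (j - \<alpha>)) = 2 * (tri i + tri j + \<alpha> * (\<alpha> + (i - j)))"
      unfolding distrib_left two_tri by (simp add: algebra_simps)
    then have "tri (i + \<alpha>) + tri (j - \<alpha>) = tri i + tri j + \<alpha> * (\<alpha> + (i - j))" by (subst (asm) mult_cancel_left) simp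
    then have 1: "q powi tri (i + \<alpha>) * q powi tri (j - \<alpha>) =
        q powi tri i * q powi tri j * q powi (\<alpha> * (\<alpha> + (i - j)))"
      using q0 by (simp flip: power_int_add)
    have "(- (h * p)) powi \<alpha> = (- h) powi \<alpha> * p powi \<alpha>"
      by (metis minus_mult_left power_int_mult_distrib)
    moreover have "(- h) powi \<alpha> \<noteq> 0" "p powi \<alpha> \<noteq> 0" using h p by auto
    ultimately have 2: "(- h) powi (i + \<alpha>) * (- (h * p)) powi (j - \<alpha>) * p powi \<alpha> =
        (- h) powi i * (- (h * p)) powi j"
      using h p by (simp add: power_int_add power_int_diff)
    have 3: "i - j + \<alpha> = \<alpha> + (i - j)" by simp
    show ?thesis
      unfolding ij d_def c_def T_def durfee_def fst_conv snd_conv 3 using 1 2 by algebra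
  qed
  have s1: "((\<lambda>ij. T h (fst ij) * T (h * p) (snd ij) * (1 / Q)) has_sum Q\<^sup>2 * cmean R f) UNIV"
    by (rule has_sum_SigmaD[OF d]) (unfold d_eq Q_def, intro has_sum_cmult_right durfee_identity q1 q0)
  have s2: "((\<lambda>ij. T h (fst ij) * T (h * p) (snd ij) * (1 / Q)) has_sum
      ((theta q h * Q) * (theta q (h * p) * Q) * (1 / Q))) (UNIV \<times> UNIV)"
    unfolding T_def Q_def using h p
    by (intro has_sum_cmult_left abs_has_sum_times jacobi_triple_product q1 q0) auto
  have "Q\<^sup>2 * cmean R f = (theta q h * Q) * (theta q (h * p) * Q) * (1 / Q)"
    by (rule has_sum_unique[OF s1 s2[unfolded UNIV_Times_UNIV]])
  also have "\<dots> = Q\<^sup>2 * (theta q h * theta q (h * p) / Q)"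
    using Q by (simp add: power2_eq_square)
  finally have "cmean R f = theta q h * theta q (h * p) / Q"
    using Q by (simp add: field_simps)
  then show ?thesis by (simp add: f_def Q_def)
qed

lemma qbin_0 [simp]: "qbin q N 0 = 1"
  using qfac_q_nonzero[OF q1] by (simp add: qbin_def)

text \<open>
  Pascal's rule in the form that leads to the recurrence of the Rogers-Szego polynomials below and
  to the finite q-binomial theorem.
\<close>

lemma qbin_pascal: "qbin q (Suc N) (Suc k) = qbin q N k + q ^ Suc k * qbin q N (Suc k)"
proof -
  consider "k < N" | "k = N" | "k > N" by linarith
  then show ?thesis
  proof cases
    case 1
    then obtain d where d: "N = Suc (k + d)" by (auto dest: less_imp_Suc_add)
    have nz: "qfac q q k \<noteq> 0" "qfac q q d \<noteq> 0" "1 - q * q ^ k \<noteq> 0" "1 - q * q ^ d \<noteq> 0"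
      using qfac_q_nonzero[OF q1] mult_power_ne_1[OF q1 q1] by auto
    have e: "Suc N - Suc k = Suc d" "N - k = Suc d" "N - Suc k = d" "Suc k \<le> Suc N" "k \<le> N" "Suc k \<le> N"
      using d by auto
    have "qfac q q N * (1 - q * q ^ N) / (qfac q q k * (1 - q * q ^ k) * (qfac q q d * (1 - q * q ^ d))) =
      qfac q q N / (qfac q q k * (qfac q q d * (1 - q * q ^ d))) +
      q * q ^ k * (qfac q q N / (qfac q q k * (1 - q * q ^ k) * qfac q q d))"
      using nz by (simp add: divide_simps) (simp add: d power_add algebra_simps)
    then show ?thesis
      using e by (simp add: qbin_def qfac_Suc)
  next
    case 2
    then show ?thesis using qfac_q_nonzero[OF q1] by (simp add: qbin_def)
  qed (simp add: qbin_def)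
qed

lemma qbin_sum_Suc:
  "(\<Sum>k\<le>Suc N. qbin q (Suc N) k * f k) =
     (\<Sum>k\<le>N. qbin q N k * f (Suc k)) + (\<Sum>k\<le>N. qbin q N k * q ^ k * f k)"
proof -
  have "(\<Sum>k\<le>Suc N. qbin q (Suc N) k * f k) =
      f 0 + (\<Sum>k\<le>N. (qbin q N k + q ^ Suc k * qbin q N (Suc k)) * f (Suc k))"
    by (simp add: sum.atMost_Suc_shift qbin_pascal del: sum.atMost_Suc)
  also have "\<dots> = (\<Sum>k\<le>N. qbin q N k * f (Suc k)) +
      (f 0 + (\<Sum>k\<le>N. qbin q N (Suc k) * q ^ Suc k * f (Suc k)))"
    by (simp add: sum.distrib algebra_simps)
  also have "f 0 + (\<Sum>k\<le>N. qbin q N (Suc k) * q ^ Suc k * f (Suc k)) = (\<Sum>k\<le>Suc N. qbin q N k * q ^ k * f k)"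
    by (subst sum.atMost_Suc_shift) simp
  also have "\<dots> = (\<Sum>k\<le>N. qbin q N k * q ^ k * f k)"
    by (simp add: qbin_def)
  finally show ?thesis .
qed

lemma rogers_szego_Suc: "rogers_szego q (Suc N) p = p * rogers_szego q N p + rogers_szego q N (p * q)"
  unfolding rogers_szego_def qbin_sum_Suc by (simp add: sum_distrib_left power_mult_distrib mult_ac)

lemma finite_qbinomial: "(\<Sum>m\<le>N. qbin q N m * hfac q 0 z m) = qfac q z N"
proof (induction N arbitrary: z)
  case (Suc N)
  have sc: "q ^ m * hfac q 0 z m = hfac q 0 (z * q) m" for m
    using hfac_scale[of q q 0 z m] by (simp add: mult.commute)
  have "(\<Sum>m\<le>Suc N. qbin q (Suc N) m * hfac q 0 z m) =
     (- z) * (\<Sum>m\<le>N. qbin q N m * hfac q 0 (z * q) m) + (\<Sum>m\<le>N. qbin q N m * hfac q 0 (z * q) m)"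
    unfolding qbin_sum_Suc hfac_zero_shift sum_distrib_left
    by (simp add: mult.assoc sc) (simp add: mult_ac)
  also have "\<dots> = qfac q z (Suc N)"
    unfolding Suc qfac_Suc_shift by (simp add: algebra_simps)
  finally show ?case .
qed simp

text \<open>
  After exchanging the sums, the coefficient of \<open>p\<^sup>k\<close> is by the finite q-binomial theorem a multiple of
  \<open>(q\<^bsup>1-k\<^esup>; q)\<^sub>N\<close>, which contains the factor \<open>1 - q\<^sup>0\<close> for \<open>1 \<le> k \<le> N\<close>.
\<close>

lemma rogers_szego_alternating_sum:
  "(\<Sum>n\<le>N. qbin q N n * hfac q 0 q (N - n) * rogers_szego q N (p * q ^ n)) = qfac q q N"
proof -
  have inner: "(\<Sum>n\<le>N. qbin q N n * hfac q 0 q (N - n) * (q ^ n) ^ k) = (if k = 0 then qfac q q N else 0)"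
    if k: "k \<le> N" for k
  proof -
    have "(\<Sum>n\<le>N. qbin q N n * hfac q 0 q (N - n) * (q ^ n) ^ k) =
        (\<Sum>m\<le>N. qbin q N (N - m) * hfac q 0 q m * (q ^ (N - m)) ^ k)"
      by (rule sum.reindex_bij_witness[of _ "\<lambda>m. N - m" "\<lambda>m. N - m"]) auto
    also have "\<dots> = (\<Sum>m\<le>N. (q ^ N) ^ k * (qbin q N m * hfac q 0 (q * inverse (q ^ k)) m))"
    proof (rule sum.cong[OF refl])
      fix m assume m: "m \<in> {..N}"
      then have 1: "qbin q N (N - m) = qbin q N m" by (simp add: qbin_def mult.commute)
      have 2: "hfac q 0 (q * inverse (q ^ k)) m = inverse (q ^ k) ^ m * hfac q 0 q m"
        using hfac_scale[of q "inverse (q ^ k)" 0 q m] by (simp add: mult.commute)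
      have 3: "(q ^ (N - m)) ^ k = (q ^ N) ^ k * inverse (q ^ k) ^ m"
      proof -
        have "(q ^ (N - m)) ^ k * (q ^ m) ^ k = (q ^ N) ^ k"
          using m by (simp flip: power_mult_distrib power_add)
        then show ?thesis using q0
          by (simp add: field_simps flip: power_mult)
      qed
      show "qbin q N (N - m) * hfac q 0 q m * (q ^ (N - m)) ^ k =
          (q ^ N) ^ k * (qbin q N m * hfac q 0 (q * inverse (q ^ k)) m)"
        unfolding 1 2 3 by simp
    qed
    also have "\<dots> = (q ^ N) ^ k * qfac q (q * inverse (q ^ k)) N"
      by (simp only: finite_qbinomial flip: sum_distrib_left)
    also have "\<dots> = (if k = 0 then qfac q q N else 0)"
    proof (cases k)
      case (Suc j)
      then have "q * inverse (q ^ k) * q ^ j = 1" "j < N" using q0 k by (auto simp: field_simps)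
      then have "qfac q (q * inverse (q ^ k)) N = 0" by (auto simp: qfac_eq_0_iff)
      with Suc show ?thesis by simp
    qed simp
    finally show ?thesis .
  qed
  have "(\<Sum>n\<le>N. qbin q N n * hfac q 0 q (N - n) * rogers_szego q N (p * q ^ n)) =
      (\<Sum>k\<le>N. qbin q N k * p ^ k * (\<Sum>n\<le>N. qbin q N n * hfac q 0 q (N - n) * (q ^ n) ^ k))"
    unfolding rogers_szego_def sum_distrib_left
    by (subst sum.swap) (simp add: power_mult_distrib mult_ac)
  also have "\<dots> = (\<Sum>k\<le>N. qbin q N k * p ^ k * (if k = 0 then qfac q q N else 0))"
    by (intro sum.cong refl arg_cong2[of _ _ _ _ "(*)"] inner) auto
  also have "\<dots> = qfac q q N" by (simp add: if_distrib cong: if_cong)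
  finally show ?thesis .
qed

lemma theta_shift:
  assumes "x \<noteq> 0"
  shows "theta q x = - x * theta q (x * q)"
proof -
  have "theta q x = (1 - x) * qinf q (x * q) * qinf q (q / x)"
    using qinf_step[OF q1, of x] by (simp add: theta_def)
  moreover have "theta q (x * q) = qinf q (x * q) * ((1 - 1 / x) * qinf q (q / x))"
    using qinf_step[OF q1, of "1 / x"] q0 by (simp add: theta_def)
  moreover have "- x * (1 - 1 / x) = 1 - x" using assms by (simp add: right_diff_distrib)
  ultimately show ?thesis by algebra
qed

lemma theta_shift_power:
  assumes "x \<noteq> 0"
  shows "theta q x = hfac q 0 x n * theta q (x * q ^ n)"
proof (induction n)
  case (Suc n)
  then show ?case using theta_shift[of "x * q ^ n"] assms q0 by (simp add: hfac_Suc mult_ac)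
qed simp

lemma continuous_on_theta:
  "continuous_on S f \<Longrightarrow> (\<And>x. x \<in> S \<Longrightarrow> f x \<noteq> 0) \<Longrightarrow> continuous_on S (\<lambda>x. theta q (f x))"
  unfolding theta_def by (intro continuous_intros q1) auto

lemma kern_nonzero:
  assumes "norm R > 1" "norm R > norm p" "norm u = norm R"
  shows "u \<noteq> 0" "qinf q (p / u) \<noteq> 0" "qinf q (1 / u) \<noteq> 0"
  using assms by (auto intro!: qinf_nonzero[OF q1] simp: norm_divide divide_less_eq_1)

lemma continuous_on_kern:
  assumes "h \<noteq> 0" "p \<noteq> 0" "norm R > 1" "norm R > norm p"
  shows "continuous_on (sphere 0 (norm R)) (kern q h p)"
  unfolding kern_def using kern_nonzero[OF assms(3,4)] assms(1,2)
  by (intro continuous_intros continuous_on_theta q1) auto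

text \<open>
  The factor \<open>(p/u; q)\<^sub>n\<close> cancels factors of the denominator, and \<open>u\<^sup>n\<close> is absorbed by the quasi-periodicity
  of \<open>theta (h p / u)\<close>. Both moves shift \<open>p\<close> to \<open>p q\<^sup>n\<close>.
\<close>

lemma kern_shift:
  assumes "h \<noteq> 0" "p \<noteq> 0" "norm R > 1" "norm R > norm p" "norm u = norm R"
  shows "kern q h p u * qfac q (p / u) n * u ^ n = hfac q 0 (h * p) n * kern q h (p * q ^ n) u"
proof -
  note nz = kern_nonzero[OF assms(3-5)]
  have "theta q (h * p / u) = hfac q 0 (h * p / u) n * theta q (h * (p * q ^ n) / u)"
    using theta_shift_power[of "h * p / u" n] assms nz by (simp add: mult.assoc)
  moreover have "hfac q 0 (h * p / u) n * u ^ n = hfac q 0 (h * p) n"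
    using hfac_scale[of q u 0 "h * p / u" n] nz by (simp add: mult.commute)
  moreover have "qinf q (p / u) = qfac q (p / u) n * qinf q (p * q ^ n / u)"
    using qinf_split[OF q1, of "p / u" n] by simp
  ultimately show ?thesis
    using nz unfolding kern_def by (simp add: field_simps)
qed

text \<open>
  Since \<open>kern h p u (1 - p/u) u = - h p kern h (p q) u\<close>, the moments for \<open>p\<close> and \<open>p q\<close> are related by the
  recurrence that defines the Rogers-Szego polynomials.
\<close>

lemma kern_moment:
  assumes "h \<noteq> 0" "p \<noteq> 0" "norm R > 1" "norm R > norm p"
  shows "cmean R (\<lambda>u. kern q h p u * u ^ N) = theta q h * theta q (h * p) / qinf q q * rogers_szego q N p"
  using assms(2,4)
proof (induction N arbitrary: p)
  case 0
  then show ?case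
    using theta_kernel_mean[OF assms(1) 0(1) assms(3) 0(2)]
    by (simp add: rogers_szego_def)
next
  case (Suc N)
  have pq: "p * q \<noteq> 0" "norm (p * q) < norm R"
  proof -
    have "norm p * norm q \<le> norm p * 1" using q1 by (intro mult_left_mono) auto
    then show "norm (p * q) < norm R" using Suc.prems(2) by (simp add: norm_mult)
  qed (use Suc.prems q0 in auto)
  have cont: "continuous_on (sphere 0 (norm R)) (\<lambda>u. kern q h p u * u ^ M)" for M
    using continuous_on_kern[OF assms(1) Suc.prems(1) assms(3) Suc.prems(2)] by (intro continuous_intros)
  have "cmean R (\<lambda>u. kern q h p u * u ^ Suc N) - p * cmean R (\<lambda>u. kern q h p u * u ^ N) =
      cmean R (\<lambda>u. kern q h p u * u ^ Suc N - p * (kern q h p u * u ^ N))"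
    by (subst cmean_diff) (auto simp: cmean_cmult simp del: power_Suc intro!: cont continuous_on_mult_left)
  also have "\<dots> = cmean R (\<lambda>u. - (h * p) * (kern q h (p * q) u * u ^ N))"
  proof (rule cmean_cong)
    fix u :: complex assume u: "norm u = norm R"
    then have "u \<noteq> 0" using assms(3) by auto
    have "kern q h p u * (1 - p / u) * u = - (h * p) * kern q h (p * q) u"
      using kern_shift[OF assms(1) Suc.prems(1) assms(3) Suc.prems(2) u, of 1]
      by (simp add: qfac_Suc hfac_Suc)
    moreover have "kern q h p u * u ^ Suc N - p * (kern q h p u * u ^ N) = kern q h p u * (1 - p / u) * u * u ^ N"
      using \<open>u \<noteq> 0\<close> by (simp add: field_simps)
    ultimately show "kern q h p u * u ^ Suc N - p * (kern q h p u * u ^ N) = - (h * p) * (kern q h (p * q) u * u ^ N)"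
      by simp
  qed
  also have "\<dots> = theta q h * (- (h * p) * theta q (h * p * q)) / qinf q q * rogers_szego q N (p * q)"
    unfolding cmean_cmult Suc.IH[OF pq] by (simp add: mult_ac)
  also have "- (h * p) * theta q (h * p * q) = theta q (h * p)"
    using theta_shift[of "h * p"] assms(1) Suc.prems by simp
  finally show ?case
    unfolding rogers_szego_Suc Suc.IH[OF Suc.prems] by (simp add: algebra_simps add_divide_distrib)
qed

text \<open>
  The q-binomial theorem expands \<open>(p x u; q) / (x u\<^sup>2; q)\<close> into the terms
  \<open>(p/u; q)\<^sub>n (x u\<^sup>2)\<^sup>n / (q; q)\<^sub>n\<close> and \<open>(q x u; q)\<close> is expanded by Euler's series with index \<open>m\<close>. In the
  coefficient of \<open>x\<^sup>N\<close>, where \<open>n + m = N\<close>, the power of \<open>u\<close> is \<open>u\<^sup>n u\<^sup>N\<close>; \<open>kern_shift\<close> absorbs \<open>u\<^sup>n\<close>,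
  and what remains is the \<open>N\<close>-th moment for \<open>p q\<^sup>n\<close>. By the alternating sum the result is independent of \<open>N\<close>.
\<close>

theorem kern_balanced_mean:
  assumes h: "h \<noteq> 0" and p: "p \<noteq> 0" and R: "norm R > 1" "norm R > norm p"
    and x: "norm x * (norm R)\<^sup>2 < 1"
  shows "cmean R (\<lambda>u. kern q h p u * (qinf q (p * x * u) * qinf q (q * x * u) / qinf q (x * u\<^sup>2))) =
    theta q h * theta q (h * p) / (qinf q q * (1 - x))"
proof -
  define r where "r = norm R"
  define a where "a u n = hfac q (x * u\<^sup>2) (p * x * u) n / qfac q q n" for u n
  define b where "b u n = hfac q 0 (q * x * u) n / qfac q q n" for u n
  define E where "E N u = kern q h p u * (\<Sum>n\<le>N. a u n * b u (N - n))" for N u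
  define L where "L = theta q h * theta q (h * p) / qinf q q"
  have "norm x * 1 \<le> norm x * (norm R)\<^sup>2"
    using R by (intro mult_left_mono) (auto simp: one_le_power)
  with x have x1: "norm x < 1" by simp
  have xu: "norm (x * u\<^sup>2) < 1" if "norm u = norm R" for u
    using x that by (simp add: norm_mult norm_power)
  have pqn: "p * q ^ n \<noteq> 0" "norm (p * q ^ n) < norm R" for n
  proof -
    have "norm p * norm q ^ n \<le> norm p * 1" using q1 by (intro mult_left_mono power_le_one) auto
    then show "norm (p * q ^ n) < norm R" using R by (simp add: norm_mult norm_power)
  qed (use p q0 in auto)
  have sums: "(\<lambda>N. E N u) sums (kern q h p u * (qinf q (p * x * u) * qinf q (q * x * u) / qinf q (x * u\<^sup>2)))"
    if u: "norm u = norm R" for u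
  proof -
    have "(\<lambda>N. \<Sum>n\<le>N. a u n * b u (N - n)) sums ((\<Sum>n. a u n) * (\<Sum>n. b u n))"
      unfolding a_def b_def
      by (intro Cauchy_product_sums qbinomial_abs_summable q1 xu u) auto
    also have "(\<Sum>n. a u n) = qinf q (p * x * u) / qinf q (x * u\<^sup>2)"
      unfolding a_def by (rule sums_unique[symmetric, OF qbinomial[OF q1 xu[OF u]]])
    also have "(\<Sum>n. b u n) = qinf q (q * x * u)"
      unfolding b_def by (rule sums_unique[symmetric, OF euler_series[OF q1]])
    finally show ?thesis unfolding E_def by (intro sums_mult) (simp add: mult_ac)
  qed
  have E_eq: "E N u = x ^ N * (\<Sum>n\<le>N. (hfac q 0 (h * p) n * hfac q 0 q (N - n) / (qfac q q n * qfac q q (N - n))) *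
       (kern q h (p * q ^ n) u * u ^ N))" if u: "norm u = norm R" for N u
  proof -
    have u0: "u \<noteq> 0" using u R by auto
    have "kern q h p u * (a u n * b u (N - n)) =
        x ^ N * ((hfac q 0 (h * p) n * hfac q 0 q (N - n) / (qfac q q n * qfac q q (N - n))) *
         (kern q h (p * q ^ n) u * u ^ N))" if n: "n \<le> N" for n
    proof -
      have 1: "hfac q (x * u\<^sup>2) (p * x * u) n = (x * u\<^sup>2) ^ n * qfac q (p / u) n"
        using hfac_scale[of q "x * u\<^sup>2" 1 "p / u" n] u0
        by (simp add: hfac_one power2_eq_square mult_ac)
      have 2: "hfac q 0 (q * x * u) (N - n) = (x * u) ^ (N - n) * hfac q 0 q (N - n)"
        using hfac_scale[of q "x * u" 0 q "N - n"] by (simp add: mult_ac)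
      have 3: "(x * u\<^sup>2) ^ n * (x * u) ^ (N - n) = x ^ N * u ^ n * u ^ N"
      proof -
        have "(x * u\<^sup>2) ^ n = (x * u) ^ n * u ^ n"
          by (simp add: power2_eq_square power_mult_distrib mult_ac)
        then have "(x * u\<^sup>2) ^ n * (x * u) ^ (N - n) = ((x * u) ^ n * (x * u) ^ (N - n)) * u ^ n"
          by (simp only: mult_ac)
        also have "(x * u) ^ n * (x * u) ^ (N - n) = x ^ N * u ^ N"
          using n by (simp flip: power_add power_mult_distrib)
        finally show ?thesis by (simp only: mult_ac)
      qed
      have "kern q h p u * (a u n * b u (N - n)) = (kern q h p u * qfac q (p / u) n) *
         ((x * u\<^sup>2) ^ n * (x * u) ^ (N - n)) * hfac q 0 q (N - n) / (qfac q q n * qfac q q (N - n))"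
        unfolding a_def b_def 1 2 by simp
      also have "\<dots> = (kern q h p u * qfac q (p / u) n * u ^ n) *
         (x ^ N * u ^ N * hfac q 0 q (N - n) / (qfac q q n * qfac q q (N - n)))"
        unfolding 3 by simp
      also have "\<dots> = x ^ N * ((hfac q 0 (h * p) n * hfac q 0 q (N - n) / (qfac q q n * qfac q q (N - n))) *
         (kern q h (p * q ^ n) u * u ^ N))"
        unfolding kern_shift[OF h p R u] by simp
      finally show ?thesis .
    qed
    then show ?thesis unfolding E_def sum_distrib_left by (intro sum.cong) auto
  qed
  have mean: "cmean R (E N) = x ^ N * L" for N
  proof -
    have cont: "continuous_on (sphere 0 (norm R)) (\<lambda>u. c * (kern q h (p * q ^ n) u * u ^ N))" for c n
      by (intro continuous_intros continuous_on_kern h R pqn)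
    have "cmean R (E N) = x ^ N * (\<Sum>n\<le>N. (hfac q 0 (h * p) n * hfac q 0 q (N - n) / (qfac q q n * qfac q q (N - n))) *
       (theta q h * theta q (h * p * q ^ n) / qinf q q * rogers_szego q N (p * q ^ n)))"
    proof -
      have "cmean R (\<lambda>u. \<Sum>n\<le>N. c n * (kern q h (p * q ^ n) u * u ^ N)) =
          (\<Sum>n\<le>N. c n * (theta q h * theta q (h * p * q ^ n) / qinf q q * rogers_szego q N (p * q ^ n)))" for c
        using kern_moment[OF h pqn(1) R(1) pqn(2)]
        by (subst cmean_sum) (simp_all only: cont cmean_cmult finite_atMost mult.assoc)
      then show ?thesis by (subst cmean_cong[OF E_eq]) (simp_all only: cmean_cmult)
    qed
    also have "\<dots> = x ^ N * (\<Sum>n\<le>N. L / qfac q q N *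
        (qbin q N n * hfac q 0 q (N - n) * rogers_szego q N (p * q ^ n)))"
    proof (rule arg_cong[of _ _ "(*) (x ^ N)"], rule sum.cong[OF refl])
      fix n assume "n \<in> {..N}"
      then have "qbin q N n = qfac q q N / (qfac q q n * qfac q q (N - n))" by (simp add: qbin_def)
      then have 1: "1 / (qfac q q n * qfac q q (N - n)) = qbin q N n / qfac q q N"
        using qfac_q_nonzero[OF q1, of N] by simp
      have "hfac q 0 (h * p) n * theta q (h * p * q ^ n) = theta q (h * p)"
        using theta_shift_power[of "h * p" n] h p by simp
      then show "hfac q 0 (h * p) n * hfac q 0 q (N - n) / (qfac q q n * qfac q q (N - n)) *
          (theta q h * theta q (h * p * q ^ n) / qinf q q * rogers_szego q N (p * q ^ n)) =
          L / qfac q q N * (qbin q N n * hfac q 0 q (N - n) * rogers_szego q N (p * q ^ n))"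
        using 1 unfolding L_def divide_inverse by (simp add: mult_ac)
    qed
    also have "\<dots> = x ^ N * L"
      using qfac_q_nonzero[OF q1, of N]
      unfolding sum_distrib_left[symmetric] rogers_szego_alternating_sum by simp
    finally show ?thesis .
  qed
  \<comment> \<open>Termwise integration over \<open>N\<close>: a convolution of two geometric series dominates.\<close>
  obtain \<rho> where \<rho>: "norm x * r\<^sup>2 < \<rho>" "\<rho> < 1" using x dense unfolding r_def by blast
  then have \<rho>0: "\<rho> > 0" by (meson le_less_trans mult_nonneg_nonneg norm_ge_zero zero_le_power2)
  obtain C1 where C1: "C1 > 0"
     "\<And>\<alpha> A n. norm \<alpha> \<le> \<rho> \<Longrightarrow> norm A \<le> norm (p * x) * r \<Longrightarrow> norm (hfac q \<alpha> A n / qfac q q n) \<le> C1 * \<rho> ^ n"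
    using qbinomial_term_bound[OF q1 \<rho>0] by metis
  obtain C2 where C2: "C2 > 0"
     "\<And>\<alpha> A n. norm \<alpha> \<le> \<rho> \<Longrightarrow> norm A \<le> norm (q * x) * r \<Longrightarrow> norm (hfac q \<alpha> A n / qfac q q n) \<le> C2 * \<rho> ^ n"
    using qbinomial_term_bound[OF q1 \<rho>0] by metis
  have contk: "continuous_on (sphere 0 (norm R)) (kern q h p)"
    by (intro continuous_on_kern h p R)
  then obtain K where K: "K > 0" "\<And>u. norm u = norm R \<Longrightarrow> norm (kern q h p u) \<le> K"
    using continuous_on_sphere_bounded by metis
  define M where "M N = K * (\<Sum>n\<le>N. (C1 * \<rho> ^ n) * (C2 * \<rho> ^ (N - n)))" for N
  have "summable M"
    unfolding M_def using \<rho>0 \<rho>(2) C1(1) C2(1)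
    by (intro summable_mult summable_Cauchy_product) (auto simp: norm_mult norm_power abs_mult intro!: summable_mult summable_geometric)
  have bound: "norm (E N u) \<le> M N" if u: "norm u = norm R" for N u
  proof -
    have "norm (E N u) \<le> norm (kern q h p u) * (\<Sum>n\<le>N. norm (a u n) * norm (b u (N - n)))"
      unfolding E_def norm_mult by (intro mult_left_mono order_trans[OF norm_sum]) (auto simp: norm_mult)
    also have "\<dots> \<le> K * (\<Sum>n\<le>N. (C1 * \<rho> ^ n) * (C2 * \<rho> ^ (N - n)))"
    proof (intro mult_mono K(2)[OF u] sum_mono)
      fix n
      show "norm (a u n) \<le> C1 * \<rho> ^ n"
        unfolding a_def using u \<rho> by (intro C1(2)) (auto simp: norm_mult norm_power r_def)
      show "norm (b u (N - n)) \<le> C2 * \<rho> ^ (N - n)"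
        unfolding b_def using u \<rho>0 by (intro C2(2)) (auto simp: norm_mult r_def)
    qed (use \<rho>0 C1 K in \<open>auto intro!: sum_nonneg mult_nonneg_nonneg\<close>)
    finally show ?thesis by (simp add: M_def)
  qed
  have contE: "continuous_on (sphere 0 (norm R)) (E N)" for N
  proof -
    have "continuous_on (sphere 0 (norm R)) (\<lambda>u. x ^ N * (\<Sum>n\<le>N. (hfac q 0 (h * p) n * hfac q 0 q (N - n) / (qfac q q n * qfac q q (N - n))) *
       (kern q h (p * q ^ n) u * u ^ N)))"
      by (intro continuous_intros continuous_on_kern h R pqn)
    then show ?thesis
      by (rule continuous_on_eq) (use E_eq in auto)
  qed
  have "(\<lambda>N. cmean R (E N)) sums cmean R (\<lambda>u. kern q h p u * (qinf q (p * x * u) * qinf q (q * x * u) / qinf q (x * u\<^sup>2)))"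
    by (rule cmean_sums[OF contE bound \<open>summable M\<close> sums])
  moreover have "(\<lambda>N. cmean R (E N)) sums (1 / (1 - x) * L)"
    unfolding mean by (intro sums_mult2 geometric_sums x1)
  ultimately have "cmean R (\<lambda>u. kern q h p u * (qinf q (p * x * u) * qinf q (q * x * u) / qinf q (x * u\<^sup>2))) =
      1 / (1 - x) * L"
    by (rule sums_unique2)
  then show ?thesis by (simp add: L_def mult.commute)
qed

end

section \<open>The very-well-poised sum\<close>

text \<open>
  This is \<open>(a; q)\<^sub>k (1 - a q\<^bsup>2k\<^esup>) / (1 - a)\<close> for \<open>A = q a\<close>, with the factor \<open>1 - a\<close> cancelled so that
  \<open>a = 1\<close> causes no division by zero when the parameter is shifted.
\<close>

definition vwp :: "complex \<Rightarrow> complex \<Rightarrow> nat \<Rightarrow> complex" where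
  "vwp q A k = (case k of 0 \<Rightarrow> 1 | Suc j \<Rightarrow> qfac q A j * (1 - A * q ^ (2 * j + 1)))"

text \<open>
  The terms of the very-well-poised series 6phi5. The argument \<open>Z = a q / (b c d)\<close> replaces \<open>a\<close> as a
  parameter, which makes the denominator parameters \<open>Z c d, Z b d, Z b c\<close> polynomial, and the shift of \<open>a\<close>
  to \<open>a q\<close> becomes that of \<open>Z\<close> to \<open>Z q\<close>.
\<close>

definition w65 :: "complex \<Rightarrow> complex \<Rightarrow> complex \<Rightarrow> complex \<Rightarrow> complex \<Rightarrow> nat \<Rightarrow> complex" where
  "w65 q b c d Z k = vwp q (Z * b * c * d) k * (qfac q b k * qfac q c k * qfac q d k) * Z ^ k /
     (qfac q q k * (qfac q (Z * c * d) k * qfac q (Z * b * d) k * qfac q (Z * b * c) k))"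

text \<open>
  The certificate of the contiguous relation: up to constant factors, \<open>w65\<close> at \<open>Z\<close> minus \<open>w65\<close> at \<open>Z q\<close> is the forward
  difference of this sequence. Its numerator \<open>1 - Z b c d Z q\<^sup>j\<close> comes from the case \<open>k = 0\<close>, where the
  difference \<open>(1 - Z) (1 - Z c d) (1 - Z b d) (1 - Z b c) - (1 - Z b) (1 - Z c) (1 - Z d) (1 - Z b c d)\<close>
  factors as \<open>- Z (1 - b) (1 - c) (1 - d) (1 - Z b c d Z)\<close>.
\<close>

definition w65_cert :: "complex \<Rightarrow> complex \<Rightarrow> complex \<Rightarrow> complex \<Rightarrow> complex \<Rightarrow> nat \<Rightarrow> complex" where
  "w65_cert q b c d Z k = (case k of 0 \<Rightarrow> 0 | Suc j \<Rightarrow>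
     - (qfac q (Z * b * c * d) j * (qfac q b k * qfac q c k * qfac q d k) * Z ^ k *
         (1 - Z * b * c * d * Z * q ^ j)) /
     (qfac q q j * (qfac q (Z * c * d) k * qfac q (Z * b * d) k * qfac q (Z * b * c) k)))"

text \<open>
  The telescoping relation for index \<open>k = j + 1\<close> after division by the common factors, with \<open>w = q\<^sup>j\<close>.
\<close>

lemma w65_polynomial_identity:
  fixes Z b c d q w :: complex
  shows "(1 - Z * b * c * d * (q * w * w)) * (1 - Z) * ((1 - Z * c * d * (q * w)) * (1 - Z * b * d * (q * w)) * (1 - Z * b * c * (q * w)))
     - (1 - Z * b) * (1 - Z * c) * (1 - Z * d) * (1 - Z * b * c * d * w) * (1 - Z * b * c * d * (q * w * (q * w))) * (q * w) =
     - ((1 - Z * b * c * d * w) * Z * ((1 - b * (q * w)) * (1 - c * (q * w)) * (1 - d * (q * w))) * (1 - Z * b * c * d * Z * (q * w)))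
     + (1 - q * w) * (1 - Z * b * c * d * Z * w) * ((1 - Z * c * d * (q * w)) * (1 - Z * b * d * (q * w)) * (1 - Z * b * c * (q * w)))"
  by algebra

context
  fixes q :: complex
  assumes q1: "norm q < 1" and q0: "q \<noteq> 0"
begin

lemma w65_telescope:
  assumes "\<And>k. Z * c * d * q ^ k \<noteq> 1" "\<And>k. Z * b * d * q ^ k \<noteq> 1" "\<And>k. Z * b * c * q ^ k \<noteq> 1"
  shows "(1 - Z) * w65 q b c d Z k -
     (1 - Z * b) * (1 - Z * c) * (1 - Z * d) * (1 - Z * b * c * d) /
     ((1 - Z * c * d) * (1 - Z * b * d) * (1 - Z * b * c)) * w65 q b c d (Z * q) k =
     w65_cert q b c d Z (Suc k) - w65_cert q b c d Z k"
proof -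
  define A B C D where ABCD: "A = Z * b * c * d" "B = Z * c * d" "C = Z * b * d" "D = Z * b * c"
  have nz: "qfac q B n \<noteq> 0" "qfac q C n \<noteq> 0" "qfac q D n \<noteq> 0" "qfac q q n \<noteq> 0"  for n
    using assms qfac_q_nonzero[OF q1] by (auto simp: qfac_eq_0_iff ABCD)
  have nz1: "1 - B \<noteq> 0" "1 - C \<noteq> 0" "1 - D \<noteq> 0"
    using nz(1-3)[of 1] by (auto simp: qfac_Suc)
  have shift: "qfac q (B * q) n = qfac q B (Suc n) / (1 - B)" "qfac q (C * q) n = qfac q C (Suc n) / (1 - C)"
     "qfac q (D * q) n = qfac q D (Suc n) / (1 - D)" for n
    using nz1 by (simp_all add: qfac_Suc_shift)
  have par: "Z * q * c * d = B * q" "Z * q * b * d = C * q" "Z * q * b * c = D * q"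
    by (simp_all add: ABCD mult_ac)
  have AD: "D * d = A" "D * q * d = A * q" by (simp_all add: ABCD)
  show ?thesis
  proof (cases k)
    case 0
    have "(1 - Z) * ((1 - B) * (1 - C) * (1 - D)) - (1 - Z * b) * (1 - Z * c) * (1 - Z * d) * (1 - A) =
        - ((1 - b) * (1 - c) * (1 - d) * Z * (1 - A * Z))"
      unfolding ABCD by algebra
    then have "(1 - Z) - (1 - Z * b) * (1 - Z * c) * (1 - Z * d) * (1 - A) / ((1 - B) * (1 - C) * (1 - D)) =
        - ((1 - b) * (1 - c) * (1 - d) * Z * (1 - A * Z)) / ((1 - B) * (1 - C) * (1 - D))"
      using nz1 by (metis (no_types, lifting) diff_divide_distrib mult_eq_0_iff nonzero_mult_div_cancel_right)
    then show ?thesis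
      unfolding 0 by (simp add: w65_def w65_cert_def vwp_def qfac_Suc AD flip: ABCD)
  next
    case (Suc j)
    define w where "w = q ^ j"
    define P where "P = qfac q b k * qfac q c k * qfac q d k * Z ^ k"
    define Q where "Q = qfac q B k * qfac q C k * qfac q D k"
    define E where "E = (1 - B * (q * w)) * (1 - C * (q * w)) * (1 - D * (q * w))"
    define X where "X = qfac q A j * P / (qfac q q k * (Q * E))"
    have w: "q ^ k = q * w" "q ^ (2 * j + 1) = q * w * w"
      by (simp_all add: Suc w_def power_add mult_2)
    have QE: "qfac q B (Suc k) * qfac q C (Suc k) * qfac q D (Suc k) = Q * E"
      by (simp add: Q_def E_def qfac_Suc w mult_ac)
    have E0: "E \<noteq> 0" and Q0: "Q \<noteq> 0" using nz[of "Suc k"] nz[of k] QE by (auto simp: Q_def)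
    have k1: "qfac q q k = qfac q q j * (1 - q * w)" by (simp add: Suc qfac_Suc w_def)
    have k0: "qfac q q j \<noteq> 0" "1 - q * w \<noteq> 0" using nz(4)[of k] unfolding k1 by auto
    have t: "w65 q b c d Z k = X * ((1 - A * (q * w * w)) * E)"
    proof -
      have "vwp q A k = qfac q A j * (1 - A * (q * w * w))"
        unfolding w(2)[symmetric] by (simp add: vwp_def Suc)
      moreover have "w65 q b c d Z k = vwp q A k * P / (qfac q q k * Q)"
        by (simp add: w65_def P_def Q_def ABCD mult_ac)
      ultimately show ?thesis unfolding X_def using E0 by simp
    qed
    have g0: "w65_cert q b c d Z k = X * - ((1 - q * w) * (1 - A * Z * w) * E)"
    proof -
      have "w65_cert q b c d Z k = - (qfac q A j * P * (1 - A * Z * w)) / (qfac q q j * Q)"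
        by (simp add: w65_cert_def P_def Q_def ABCD w_def Suc mult_ac)
      then show ?thesis unfolding X_def k1 using E0 k0 by simp
    qed
    have g1: "w65_cert q b c d Z (Suc k) = X * - ((1 - A * w) * Z * ((1 - b * (q * w)) * (1 - c * (q * w)) * (1 - d * (q * w))) * (1 - A * Z * (q * w)))"
    proof -
      have "w65_cert q b c d Z (Suc k) = - (qfac q A k * (qfac q b (Suc k) * qfac q c (Suc k) * qfac q d (Suc k)) * Z ^ Suc k *
         (1 - A * Z * q ^ k)) / (qfac q q k * (Q * E))"
        unfolding w65_cert_def QE[symmetric] by (simp add: ABCD)
      also have "qfac q A k = qfac q A j * (1 - A * w)" by (simp add: Suc qfac_Suc w_def)
      finally show ?thesis unfolding X_def P_def by (simp add: qfac_Suc w mult_ac)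
    qed
    have t': "(1 - Z * b) * (1 - Z * c) * (1 - Z * d) * (1 - A) / ((1 - B) * (1 - C) * (1 - D)) * w65 q b c d (Z * q) k =
        X * ((1 - Z * b) * (1 - Z * c) * (1 - Z * d) * (1 - A * w) * (1 - A * (q * w * (q * w))) * (q * w))"
    proof -
      have v: "(1 - A) * vwp q (A * q) k = qfac q A j * (1 - A * w) * (1 - A * (q * w * (q * w)))"
      proof -
        have "(1 - A) * vwp q (A * q) k = qfac q A (Suc j) * (1 - A * q * q ^ (2 * j + 1))"
          by (simp add: vwp_def Suc qfac_Suc_shift)
        also have "A * q * q ^ (2 * j + 1) = A * (q * w * (q * w))" unfolding w by (simp add: mult_ac)
        also have "qfac q A (Suc j) = qfac q A j * (1 - A * w)" by (simp add: qfac_Suc w_def)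
        finally show ?thesis .
      qed
      have "w65 q b c d (Z * q) k = vwp q (A * q) k * P * (q * w) * ((1 - B) * (1 - C) * (1 - D)) / (qfac q q k * (Q * E))"
        unfolding w65_def par AD(2) shift P_def QE[symmetric] by (simp add: power_mult_distrib w mult_ac)
      then have "(1 - Z * b) * (1 - Z * c) * (1 - Z * d) * (1 - A) / ((1 - B) * (1 - C) * (1 - D)) * w65 q b c d (Z * q) k =
         (1 - Z * b) * (1 - Z * c) * (1 - Z * d) * ((1 - A) * vwp q (A * q) k) * P * (q * w) / (qfac q q k * (Q * E))"
        using nz1 by simp
      also have "\<dots> = X * ((1 - Z * b) * (1 - Z * c) * (1 - Z * d) * (1 - A * w) * (1 - A * (q * w * (q * w))) * (q * w))"
        unfolding v X_def by (simp add: mult_ac)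
      finally show ?thesis .
    qed
    have id: "(1 - A * (q * w * w)) * (1 - Z) * E
     - (1 - Z * b) * (1 - Z * c) * (1 - Z * d) * (1 - A * w) * (1 - A * (q * w * (q * w))) * (q * w) =
     - ((1 - A * w) * Z * ((1 - b * (q * w)) * (1 - c * (q * w)) * (1 - d * (q * w))) * (1 - A * Z * (q * w)))
     + (1 - q * w) * (1 - A * Z * w) * E"
      unfolding E_def ABCD by (rule w65_polynomial_identity)
    show ?thesis
      unfolding ABCD(2-4)[symmetric] AD(1) t g0 g1 t' using arg_cong[OF id, of "\<lambda>v. X * v"]
      by (simp only: ring_distribs) (simp add: algebra_simps)
  qed
qed

text \<open>
  Uniformity in the shift \<open>n\<close> comes from \<open>(e; q)\<^bsub>n+k\<^esub> = (e; q)\<^sub>n (e q\<^sup>n; q)\<^sub>k\<close>.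
\<close>

lemma inverse_qfac_shift_bounded:
  assumes "\<And>j. e * q ^ j \<noteq> 1"
  obtains B where "B > 0" "\<And>n k. norm (1 / qfac q (e * q ^ n) k) \<le> B"
proof -
  obtain B where B: "B > 0" "\<And>n. norm (1 / qfac q e n) \<le> B"
    using inverse_qfac_bounded[OF q1 assms] by metis
  have "norm (1 / qfac q (e * q ^ n) k) \<le> exp (norm e / (1 - norm q)) * B" for n k
  proof -
    have "qfac q e n \<noteq> 0" using assms by (auto simp: qfac_eq_0_iff)
    then have "1 / qfac q (e * q ^ n) k = qfac q e n * (1 / qfac q e (n + k))"
      by (simp add: qfac_add)
    then show ?thesis
      by (simp only: norm_mult) (intro mult_mono norm_qfac_le q1 B, auto)
  qed
  then show ?thesis using that[of "exp (norm e / (1 - norm q)) * B"] B(1) by simp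
qed

lemma norm_vwp_le: "norm (vwp q A k) \<le> exp (norm A / (1 - norm q)) * (1 + norm A)"
proof (cases k)
  case 0
  have "1 * 1 \<le> exp (norm A / (1 - norm q)) * (1 + norm A)"
    using q1 by (intro mult_mono) auto
  then show ?thesis by (simp add: 0 vwp_def)
next
  case (Suc j)
  have "norm (1 - A * q ^ (2 * j + 1)) \<le> 1 + norm A * norm q ^ (2 * j + 1)"
    using norm_triangle_ineq4[of 1 "A * q ^ (2 * j + 1)"] by (simp add: norm_mult norm_power)
  also have "\<dots> \<le> 1 + norm A * 1"
    using q1 by (intro add_left_mono mult_left_mono power_le_one) auto
  finally show ?thesis
    unfolding Suc vwp_def by (simp add: norm_mult) (intro mult_mono norm_qfac_le q1, auto)
qed

lemma w65_bound:
  assumes "\<And>k. Z * c * d * q ^ k \<noteq> 1" "\<And>k. Z * b * d * q ^ k \<noteq> 1" "\<And>k. Z * b * c * q ^ k \<noteq> 1"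
  obtains K where "K > 0" "\<And>n k. norm (w65 q b c d (Z * q ^ n) k) \<le> K * norm (Z * q ^ n) ^ k"
proof -
  define X where "X e = exp (norm e / (1 - norm q))" for e :: complex
  obtain B0 where B0: "B0 > 0" "\<And>k. norm (1 / qfac q q k) \<le> B0"
    using inverse_qfac_bounded[OF q1, of q] mult_power_ne_1[OF q1] q1 by metis
  obtain B1 where B1: "B1 > 0" "\<And>n k. norm (1 / qfac q (Z * c * d * q ^ n) k) \<le> B1"
    using inverse_qfac_shift_bounded[OF assms(1)] by metis
  obtain B2 where B2: "B2 > 0" "\<And>n k. norm (1 / qfac q (Z * b * d * q ^ n) k) \<le> B2"
    using inverse_qfac_shift_bounded[OF assms(2)] by metis
  obtain B3 where B3: "B3 > 0" "\<And>n k. norm (1 / qfac q (Z * b * c * q ^ n) k) \<le> B3"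
    using inverse_qfac_shift_bounded[OF assms(3)] by metis
  define V where "V = X (Z * b * c * d) * (1 + norm (Z * b * c * d))"
  define K where "K = V * (X b * X c * X d) * (B0 * (B1 * B2 * B3))"
  have XV: "X e > 0" "V > 0" for e unfolding V_def X_def by (auto intro!: mult_pos_pos add_pos_nonneg)
  have "norm (w65 q b c d (Z * q ^ n) k) \<le> K * norm (Z * q ^ n) ^ k" for n k
  proof -
    have comm: "Z * q ^ n * x * y = Z * x * y * q ^ n" for x y by (simp add: mult_ac)
    have "norm (vwp q (Z * q ^ n * b * c * d) k) \<le> V"
    proof -
      have le: "norm (Z * q ^ n * b * c * d) \<le> norm (Z * b * c * d)"
      proof -
        have "norm (Z * b * c * d) * norm q ^ n \<le> norm (Z * b * c * d) * 1"
          using q1 by (intro mult_left_mono power_le_one) auto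
        then show ?thesis by (simp add: norm_mult norm_power mult_ac)
      qed
      have "norm (vwp q (Z * q ^ n * b * c * d) k) \<le>
          exp (norm (Z * q ^ n * b * c * d) / (1 - norm q)) * (1 + norm (Z * q ^ n * b * c * d))"
        by (rule norm_vwp_le)
      also have "\<dots> \<le> V"
        unfolding V_def X_def using q1 le
        by (intro mult_mono) (auto intro!: divide_right_mono)
      finally show ?thesis .
    qed
    moreover have "norm (qfac q b k * qfac q c k * qfac q d k) \<le> X b * X c * X d"
      unfolding norm_mult X_def by (intro mult_mono norm_qfac_le q1) auto
    moreover have "norm (1 / qfac q q k * (1 / qfac q (Z * c * d * q ^ n) k * (1 / qfac q (Z * b * d * q ^ n) k) *
        (1 / qfac q (Z * b * c * q ^ n) k))) \<le> B0 * (B1 * B2 * B3)"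
      unfolding norm_mult using B0(1) B1(1) B2(1) B3(1)
      by (intro mult_mono B0 B1 B2 B3) auto
    ultimately have "norm (vwp q (Z * q ^ n * b * c * d) k) * norm (qfac q b k * qfac q c k * qfac q d k) *
        norm (1 / qfac q q k * (1 / qfac q (Z * c * d * q ^ n) k * (1 / qfac q (Z * b * d * q ^ n) k) *
        (1 / qfac q (Z * b * c * q ^ n) k))) \<le> K"
      unfolding K_def using XV B0(1) B1(1) B2(1) B3(1)
      by (intro mult_mono) (auto intro!: mult_nonneg_nonneg simp: less_imp_le)
    then have "norm (vwp q (Z * q ^ n * b * c * d) k) * norm (qfac q b k * qfac q c k * qfac q d k) *
        norm (1 / qfac q q k * (1 / qfac q (Z * c * d * q ^ n) k * (1 / qfac q (Z * b * d * q ^ n) k) *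
        (1 / qfac q (Z * b * c * q ^ n) k))) * norm (Z * q ^ n) ^ k \<le> K * norm (Z * q ^ n) ^ k"
      by (intro mult_right_mono) auto
    then show ?thesis
      unfolding w65_def comm by (simp add: norm_mult norm_divide norm_power mult_ac)
  qed
  moreover have "K > 0" unfolding K_def using XV B0(1) B1(1) B2(1) B3(1) by simp
  ultimately show ?thesis using that by blast
qed

lemma mult_shift_ne_1: "(\<And>k. e * q ^ k \<noteq> 1) \<Longrightarrow> e * q ^ n * q ^ k \<noteq> 1"
  by (metis mult.assoc power_add)

lemma w65_abs_summable:
  assumes Z: "norm Z < 1" and nz: "\<And>k. Z * c * d * q ^ k \<noteq> 1" "\<And>k. Z * b * d * q ^ k \<noteq> 1" "\<And>k. Z * b * c * q ^ k \<noteq> 1"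
  shows "summable (\<lambda>k. norm (w65 q b c d Z k))"
proof -
  obtain K where K: "\<And>n k. norm (w65 q b c d (Z * q ^ n) k) \<le> K * norm (Z * q ^ n) ^ k"
    using w65_bound[OF nz] by metis
  have "norm (norm (w65 q b c d Z k)) \<le> K * norm Z ^ k" for k
    using K[of 0 k] by simp
  moreover have "summable (\<lambda>k. K * norm Z ^ k)"
    using Z by (intro summable_mult summable_geometric) simp
  ultimately show ?thesis by (rule summable_comparison_test'[rotated])
qed

lemma w65_cert_tendsto:
  assumes Z: "norm Z < 1" and nz: "\<And>k. Z * c * d * q ^ k \<noteq> 1" "\<And>k. Z * b * d * q ^ k \<noteq> 1" "\<And>k. Z * b * c * q ^ k \<noteq> 1"
  shows "w65_cert q b c d Z \<longlonglongrightarrow> 0"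
proof -
  have lim: "(\<lambda>j. - (qfac q (Z * b * c * d) j * (qfac q b (Suc j) * qfac q c (Suc j) * qfac q d (Suc j)) * Z ^ Suc j *
         (1 - Z * b * c * d * Z * q ^ j)) /
     (qfac q q j * (qfac q (Z * c * d) (Suc j) * qfac q (Z * b * d) (Suc j) * qfac q (Z * b * c) (Suc j))))
     \<longlonglongrightarrow> - (qinf q (Z * b * c * d) * (qinf q b * qinf q c * qinf q d) * 0 *
         (1 - Z * b * c * d * Z * 0)) /
     (qinf q q * (qinf q (Z * c * d) * qinf q (Z * b * d) * qinf q (Z * b * c)))"
  proof -
    have "qinf q (Z * c * d) \<noteq> 0" "qinf q (Z * b * d) \<noteq> 0" "qinf q (Z * b * c) \<noteq> 0" "qinf q q \<noteq> 0"
      using nz qinf_nonzero[OF q1 q1] by (auto simp: qinf_eq_0_iff[OF q1])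
    moreover note l = qfac_tendsto_qinf[OF q1] LIMSEQ_Suc[OF qfac_tendsto_qinf[OF q1]]
      LIMSEQ_Suc[OF LIMSEQ_power_zero[OF Z]] LIMSEQ_power_zero[OF q1]
    ultimately show ?thesis by (intro tendsto_intros l) auto
  qed
  have "(\<lambda>j. w65_cert q b c d Z (Suc j)) \<longlonglongrightarrow> 0"
    using lim by (simp add: w65_cert_def)
  then show ?thesis by (rule LIMSEQ_imp_Suc)
qed

text \<open>
  Summation of the telescoping relation; the boundary terms vanish because the certificate starts
  at 0 and tends to 0.
\<close>

lemma w65_contiguous:
  assumes Z: "norm Z < 1" and nz: "\<And>k. Z * c * d * q ^ k \<noteq> 1" "\<And>k. Z * b * d * q ^ k \<noteq> 1" "\<And>k. Z * b * c * q ^ k \<noteq> 1"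
  shows "(1 - Z) * ((1 - Z * c * d) * (1 - Z * b * d) * (1 - Z * b * c)) * (\<Sum>k. w65 q b c d Z k) =
     (1 - Z * b) * (1 - Z * c) * (1 - Z * d) * (1 - Z * b * c * d) * (\<Sum>k. w65 q b c d (Z * q) k)"
proof -
  define \<rho> where "\<rho> = (1 - Z * b) * (1 - Z * c) * (1 - Z * d) * (1 - Z * b * c * d) /
     ((1 - Z * c * d) * (1 - Z * b * d) * (1 - Z * b * c))"
  have "norm (Z * q) < 1"
  proof -
    have "norm Z * norm q \<le> norm Z * 1" using q1 by (intro mult_left_mono) auto
    then show ?thesis using Z by (simp add: norm_mult)
  qed
  moreover have "Z * q * c * d * q ^ k \<noteq> 1" "Z * q * b * d * q ^ k \<noteq> 1" "Z * q * b * c * q ^ k \<noteq> 1" for k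
    using nz[of "Suc k"] by (simp_all add: mult_ac)
  ultimately have s2: "summable (w65 q b c d (Z * q))"
    by (intro summable_norm_cancel[OF w65_abs_summable]) auto
  have s1: "summable (w65 q b c d Z)"
    by (intro summable_norm_cancel[OF w65_abs_summable] assms)
  have "(\<lambda>k. (1 - Z) * w65 q b c d Z k - \<rho> * w65 q b c d (Z * q) k) sums
      ((1 - Z) * (\<Sum>k. w65 q b c d Z k) - \<rho> * (\<Sum>k. w65 q b c d (Z * q) k))"
    by (intro sums_diff sums_mult summable_sums s1 s2)
  moreover have "(\<lambda>k. (1 - Z) * w65 q b c d Z k - \<rho> * w65 q b c d (Z * q) k) sums 0"
    using telescope_sums[OF w65_cert_tendsto[OF assms]] unfolding \<rho>_def w65_telescope[OF nz]
    by (simp add: w65_cert_def)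
  ultimately have "(1 - Z) * (\<Sum>k. w65 q b c d Z k) - \<rho> * (\<Sum>k. w65 q b c d (Z * q) k) = 0"
    by (rule sums_unique2)
  moreover have "(1 - Z * c * d) * (1 - Z * b * d) * (1 - Z * b * c) \<noteq> 0"
    using nz[of 0] by auto
  then have "\<rho> * ((1 - Z * c * d) * (1 - Z * b * d) * (1 - Z * b * c)) =
      (1 - Z * b) * (1 - Z * c) * (1 - Z * d) * (1 - Z * b * c * d)"
    unfolding \<rho>_def by simp
  ultimately show ?thesis by algebra
qed

lemma w65_sum_tendsto:
  assumes Z: "norm Z < 1" and nz: "\<And>k. Z * c * d * q ^ k \<noteq> 1" "\<And>k. Z * b * d * q ^ k \<noteq> 1" "\<And>k. Z * b * c * q ^ k \<noteq> 1"
  shows "(\<lambda>n. \<Sum>k. w65 q b c d (Z * q ^ n) k) \<longlonglongrightarrow> 1"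
proof -
  obtain K where K: "K > 0" "\<And>n k. norm (w65 q b c d (Z * q ^ n) k) \<le> K * norm (Z * q ^ n) ^ k"
    using w65_bound[OF nz] by metis
  have geo: "summable (\<lambda>k. K * norm Z ^ k)"
    using Z by (intro summable_mult summable_geometric) auto
  have le: "norm ((\<Sum>k. w65 q b c d (Z * q ^ n) k) - 1) \<le> (\<Sum>k. K * norm Z ^ Suc k) * norm q ^ n" for n
  proof -
    have bnd: "norm (w65 q b c d (Z * q ^ n) (Suc k)) \<le> K * norm Z ^ Suc k * norm q ^ n" for k
    proof -
      have "(norm q ^ n) ^ Suc k \<le> norm q ^ n"
        using power_decreasing[of 1 "Suc k" "norm q ^ n"] q1 by (simp add: power_le_one)
      then have "K * norm Z ^ Suc k * (norm q ^ n) ^ Suc k \<le> K * norm Z ^ Suc k * norm q ^ n"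
        using K(1) by (intro mult_left_mono) auto
      with K(2)[of n "Suc k"] show ?thesis by (simp add: norm_mult norm_power power_mult_distrib mult_ac)
    qed
    have geo': "summable (\<lambda>k. K * norm Z ^ Suc k * norm q ^ n)"
      using geo by (intro summable_mult2) (subst summable_Suc_iff)
    have "summable (\<lambda>k. w65 q b c d (Z * q ^ n) (Suc k))"
      by (rule summable_comparison_test'[OF geo' bnd])
    then have s: "summable (w65 q b c d (Z * q ^ n))" by (subst (asm) summable_Suc_iff)
    have "(\<Sum>k. w65 q b c d (Z * q ^ n) k) - 1 = (\<Sum>k. w65 q b c d (Z * q ^ n) (Suc k))"
    proof -
      have "w65 q b c d (Z * q ^ n) 0 = 1" by (simp add: w65_def vwp_def)
      with suminf_split_head[OF s] show ?thesis by simp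
    qed
    also have "norm \<dots> \<le> (\<Sum>k. K * norm Z ^ Suc k * norm q ^ n)"
      by (rule norm_suminf_le[OF bnd geo'])
    also have "\<dots> = (\<Sum>k. K * norm Z ^ Suc k) * norm q ^ n"
      using geo by (intro suminf_mult2[symmetric]) (subst summable_Suc_iff)
    finally show ?thesis .
  qed
  have "(\<lambda>n. (\<Sum>k. K * norm Z ^ Suc k) * norm q ^ n) \<longlonglongrightarrow> 0"
    using tendsto_mult_left[OF LIMSEQ_power_zero[of "norm q"], of "\<Sum>k. K * norm Z ^ Suc k"] q1 by simp
  then have "(\<lambda>n. (\<Sum>k. w65 q b c d (Z * q ^ n) k) - 1) \<longlonglongrightarrow> 0"
    by (rule Lim_null_comparison[OF always_eventually, rotated]) (use le in blast)
  then show ?thesis by (simp add: LIM_zero_iff)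
qed

text \<open>
  Iterating the contiguous relation multiplies the sum by finite products whose limits are the
  infinite products claimed, while the sum at \<open>Z q\<^sup>n\<close> tends to its first term 1.
\<close>

theorem w65_sum:
  assumes Z: "norm Z < 1" and nz: "\<And>k. Z * c * d * q ^ k \<noteq> 1" "\<And>k. Z * b * d * q ^ k \<noteq> 1" "\<And>k. Z * b * c * q ^ k \<noteq> 1"
  shows "w65 q b c d Z sums
    (qinf q (Z * b) * qinf q (Z * c) * qinf q (Z * d) * qinf q (Z * b * c * d) /
      (qinf q Z * (qinf q (Z * c * d) * qinf q (Z * b * d) * qinf q (Z * b * c))))"
proof -
  define S where "S n = (\<Sum>k. w65 q b c d (Z * q ^ n) k)" for n
  have iter: "qfac q Z n * (qfac q (Z * c * d) n * qfac q (Z * b * d) n * qfac q (Z * b * c) n) * S 0 =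
     qfac q (Z * b) n * qfac q (Z * c) n * qfac q (Z * d) n * qfac q (Z * b * c * d) n * S n" for n
  proof (induction n)
    case (Suc n)
    have comm: "Z * q ^ n * x = Z * x * q ^ n" for x by (simp add: mult_ac)
    have Zn: "norm (Z * q ^ n) < 1"
    proof -
      have "norm Z * norm q ^ n \<le> norm Z * 1" using q1 by (intro mult_left_mono power_le_one) auto
      then show ?thesis using Z by (simp add: norm_mult norm_power)
    qed
    have "(1 - Z * q ^ n) * ((1 - Z * c * d * q ^ n) * (1 - Z * b * d * q ^ n) * (1 - Z * b * c * q ^ n)) * S n =
     (1 - Z * b * q ^ n) * (1 - Z * c * q ^ n) * (1 - Z * d * q ^ n) * (1 - Z * b * c * d * q ^ n) * S (Suc n)"
    proof -
      have y: "Z * q ^ n * c * d = Z * c * d * q ^ n" "Z * q ^ n * b * d = Z * b * d * q ^ n"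
        "Z * q ^ n * b * c = Z * b * c * q ^ n" "Z * q ^ n * b * c * d = Z * b * c * d * q ^ n"
        by (simp_all add: mult_ac)
      have "Z * q ^ n * c * d * q ^ k \<noteq> 1" "Z * q ^ n * b * d * q ^ k \<noteq> 1" "Z * q ^ n * b * c * q ^ k \<noteq> 1" for k
        unfolding y by (rule mult_shift_ne_1 nz)+
      note w65_contiguous[OF Zn this]
      moreover have "Z * q ^ n * q = Z * q ^ Suc n" by simp
      moreover have "Z * x * q ^ n * y = Z * x * y * q ^ n" "Z * x * y * q ^ n * z = Z * x * y * z * q ^ n" for x y z
        by (simp_all add: mult_ac)
      ultimately show ?thesis unfolding S_def by (simp only: comm)
    qed
    note step = this
    have "\<alpha> * \<gamma> * s = \<beta> * \<delta> * s''" if "\<alpha> * s = \<beta> * s'" "\<gamma> * s' = \<delta> * s''"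
      for \<alpha> \<beta> \<gamma> \<delta> s s' s'' :: complex
    proof -
      have "\<alpha> * \<gamma> * s = \<gamma> * (\<alpha> * s)" by simp
      also have "\<dots> = \<beta> * (\<gamma> * s')" using that(1) by simp
      finally show ?thesis using that(2) by simp
    qed
    from this[OF Suc step] show ?case unfolding qfac_Suc by (simp only: mult_ac)
  qed simp
  note l = qfac_tendsto_qinf[OF q1]
  have "(\<lambda>n. qfac q Z n * (qfac q (Z * c * d) n * qfac q (Z * b * d) n * qfac q (Z * b * c) n) * S 0)
     \<longlonglongrightarrow> qinf q Z * (qinf q (Z * c * d) * qinf q (Z * b * d) * qinf q (Z * b * c)) * S 0"
    by (intro tendsto_intros l)
  moreover have "(\<lambda>n. qfac q Z n * (qfac q (Z * c * d) n * qfac q (Z * b * d) n * qfac q (Z * b * c) n) * S 0)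
     \<longlonglongrightarrow> qinf q (Z * b) * qinf q (Z * c) * qinf q (Z * d) * qinf q (Z * b * c * d) * 1"
    unfolding iter using w65_sum_tendsto[OF assms] by (intro tendsto_intros l) (simp add: S_def)
  ultimately have "qinf q Z * (qinf q (Z * c * d) * qinf q (Z * b * d) * qinf q (Z * b * c)) * S 0 =
     qinf q (Z * b) * qinf q (Z * c) * qinf q (Z * d) * qinf q (Z * b * c * d) * 1"
    by (rule LIMSEQ_unique)
  moreover have "qinf q Z \<noteq> 0" "qinf q (Z * c * d) \<noteq> 0" "qinf q (Z * b * d) \<noteq> 0" "qinf q (Z * b * c) \<noteq> 0"
    using nz qinf_nonzero[OF q1 Z] by (auto simp: qinf_eq_0_iff[OF q1])
  ultimately have "S 0 = qinf q (Z * b) * qinf q (Z * c) * qinf q (Z * d) * qinf q (Z * b * c * d) /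
      (qinf q Z * (qinf q (Z * c * d) * qinf q (Z * b * d) * qinf q (Z * b * c)))"
    by (simp add: field_simps)
  moreover have "summable (w65 q b c d Z)"
    by (intro summable_norm_cancel[OF w65_abs_summable] assms)
  ultimately show ?thesis by (simp add: S_def sums_iff)
qed

end

section \<open>The integral representation\<close>

text \<open>
  The terms of the 5W4 series with \<open>q a\<close> written as \<open>p b c z\<close>, which makes \<open>q a / b\<close> and \<open>q a / c\<close> polynomial.
\<close>

definition w54_term :: "complex \<Rightarrow> complex \<Rightarrow> complex \<Rightarrow> complex \<Rightarrow> complex \<Rightarrow> nat \<Rightarrow> complex" where
  "w54_term q p b c z k = vwp q (p * b * c * z) k * (qfac q b k * qfac q c k) * z ^ k /
     (qfac q q k * (qfac q (z * c * p) k * qfac q (z * b * p) k))"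

context
  fixes q :: complex
  assumes q1: "norm q < 1" and q0: "q \<noteq> 0"
begin

lemma w54_term_bound:
  assumes "\<And>k. z * c * p * q ^ k \<noteq> 1" "\<And>k. z * b * p * q ^ k \<noteq> 1"
  obtains K where "K > 0" "\<And>k. norm (w54_term q p b c z k) \<le> K * norm z ^ k"
proof -
  define X where "X e = exp (norm e / (1 - norm q))" for e :: complex
  define V where "V = X (p * b * c * z) * (1 + norm (p * b * c * z))"
  obtain B0 where B0: "B0 > 0" "\<And>k. norm (1 / qfac q q k) \<le> B0"
    using inverse_qfac_bounded[OF q1, of q] mult_power_ne_1[OF q1] q1 by metis
  obtain B1 where B1: "B1 > 0" "\<And>k. norm (1 / qfac q (z * c * p) k) \<le> B1"
    using inverse_qfac_bounded[OF q1 assms(1)] by metis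
  obtain B2 where B2: "B2 > 0" "\<And>k. norm (1 / qfac q (z * b * p) k) \<le> B2"
    using inverse_qfac_bounded[OF q1 assms(2)] by metis
  have XV: "X e > 0" "V > 0" for e unfolding V_def X_def by (auto intro!: mult_pos_pos add_pos_nonneg)
  have "norm (w54_term q p b c z k) \<le> (V * (X b * X c) * (B0 * (B1 * B2))) * norm z ^ k" for k
  proof -
    have "w54_term q p b c z k = (vwp q (p * b * c * z) k * (qfac q b k * qfac q c k) *
        (1 / qfac q q k * (1 / qfac q (z * c * p) k * (1 / qfac q (z * b * p) k)))) * z ^ k"
      by (simp add: w54_term_def)
    also have "norm \<dots> \<le> (V * (X b * X c) * (B0 * (B1 * B2))) * norm z ^ k"
      unfolding norm_mult[of _ "z ^ k"] norm_power
    proof (rule mult_right_mono)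
      show "norm (vwp q (p * b * c * z) k * (qfac q b k * qfac q c k) *
        (1 / qfac q q k * (1 / qfac q (z * c * p) k * (1 / qfac q (z * b * p) k)))) \<le> V * (X b * X c) * (B0 * (B1 * B2))"
        using XV(2) XV(1)[of b] XV(1)[of c] B0(1) B1(1) B2(1)
        unfolding norm_mult
        by (intro mult_mono B0 B1 B2 norm_vwp_le[OF q1 q0, of "p * b * c * z", folded X_def, folded V_def]
             norm_qfac_le[OF q1, folded X_def]) (auto intro!: mult_nonneg_nonneg less_imp_le)
    qed auto
    finally show ?thesis .
  qed
  moreover have "V * (X b * X c) * (B0 * (B1 * B2)) > 0" using XV B0 B1 B2 by simp
  ultimately show ?thesis using that by blast
qed

text \<open>
  The theorem in the variables without square roots. The very-well-poised sum with \<open>d = p / v\<close> and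
  \<open>Z = z v\<close> has the \<open>v\<close>-independent parameters \<open>Z c d = z c p\<close> and \<open>Z b d = z b p\<close>, so the integrand is a
  series \<open>F k v\<close> in which \<open>v\<close> enters only through \<open>v\<^sup>k (p/v; q)\<^sub>k\<close> and \<open>(p x v q\<^sup>k; q)\<close>. By
  \<open>kern_shift\<close> each term is a \<open>kern_balanced_mean\<close> integrand for \<open>p q\<^sup>k\<close>, and
  quasi-periodicity of theta makes its mean independent of \<open>k\<close> apart from the coefficient.
\<close>

theorem w54_mean:
  assumes h: "h \<noteq> 0" and p: "p \<noteq> 0" and R: "norm R > 1" "norm R > norm p"
    and zR: "norm (z * R) < 1" and xR: "norm (b * c * z / p) * (norm R)\<^sup>2 < 1"
    and nz: "\<And>k. z * c * p * q ^ k \<noteq> 1" "\<And>k. z * b * p * q ^ k \<noteq> 1"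
  shows "(\<lambda>k. w54_term q p b c z k * (theta q h * theta q (h * p) / (qinf q q * (1 - b * c * z / p)))) sums
    (qinf q (z * p) * qinf q (p * b * c * z) / (qinf q (z * c * p) * qinf q (z * b * p)) *
     cmean R (\<lambda>v. kern q h p v * (qinf q (z * b * v) * qinf q (z * c * v) * qinf q (q * (b * c * z / p) * v) /
        (qinf q (z * v) * qinf q (b * c * z / p * v\<^sup>2)))))"
proof -
  define x where "x = b * c * z / p"
  have px: "p * x = b * c * z" using p by (simp add: x_def)
  define I where "I v = kern q h p v * (qinf q (z * b * v) * qinf q (z * c * v) * qinf q (q * x * v) /
        (qinf q (z * v) * qinf q (x * v\<^sup>2)))" for v
  \<comment> \<open>\<open>\<kappa>\<close> is multiplied out instead of divided by, since \<open>z p = q a / (b c)\<close> may be a zero of \<open>qinf q\<close>.\<close>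
  define \<kappa> where "\<kappa> = qinf q (z * p) * qinf q (p * b * c * z) / (qinf q (z * c * p) * qinf q (z * b * p))"
  define G where "G v = kern q h p v * (qinf q (q * x * v) / qinf q (x * v\<^sup>2))" for v
  define F where "F k v = w54_term q p b c z k * (hfac q 0 (h * p) k *
      (kern q h (p * q ^ k) v * (qinf q (p * q ^ k * x * v) * qinf q (q * x * v) / qinf q (x * v\<^sup>2))))" for k v
  have xR': "norm x * (norm R)\<^sup>2 < 1" using xR by (simp only: x_def)
  have xv: "norm (x * v\<^sup>2) < 1" if "norm v = norm R" for v
    using xR' that by (simp add: norm_mult norm_power)
  have pxv: "norm (p * x * v) < 1" if "norm v = norm R" for v
  proof -
    have "norm p * (norm x * norm R) \<le> norm R * (norm x * norm R)"
      using R by (intro mult_right_mono) auto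
    also have "\<dots> < 1" using xR' by (simp add: power2_eq_square mult_ac)
    finally show ?thesis using that by (simp add: norm_mult mult_ac)
  qed
  have pq: "p * q ^ k \<noteq> 0" "norm (p * q ^ k) < norm R" for k
  proof -
    have "norm p * norm q ^ k \<le> norm p * 1" using q1 by (intro mult_left_mono power_le_one) auto
    then show "norm (p * q ^ k) < norm R" using R by (simp add: norm_mult norm_power)
  qed (use p q0 in auto)
  have F_eq: "F k v = G v * (w54_term q p b c z k * v ^ k * qfac q (p / v) k * qinf q (p * x * v * q ^ k))"
    if v: "norm v = norm R" for k v
  proof -
    have "F k v = w54_term q p b c z k * (hfac q 0 (h * p) k * kern q h (p * q ^ k) v) *
        (qinf q (p * x * v * q ^ k) * qinf q (q * x * v) / qinf q (x * v\<^sup>2))"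
      unfolding F_def by (simp add: mult_ac)
    then show ?thesis
      unfolding kern_shift[OF q1 q0 h p R v, symmetric] G_def by (simp add: mult_ac)
  qed
  have contG: "continuous_on (sphere 0 (norm R)) G"
    unfolding G_def using qinf_nonzero[OF q1 xv]
    by (intro continuous_intros continuous_on_kern q1 q0 h p R) auto
  have contF: "continuous_on (sphere 0 (norm R)) (F k)" for k
    unfolding F_def using qinf_nonzero[OF q1 xv]
    by (intro continuous_intros continuous_on_kern q1 q0 h pq R) auto
  have sums: "(\<lambda>k. F k v) sums (\<kappa> * I v)" if v: "norm v = norm R" for v
  proof -
    have v0: "v \<noteq> 0" using v R by auto
    have par: "z * v * b = z * b * v" "z * v * c = z * c * v" "z * v * (p / v) = z * p"
      "z * c * v * (p / v) = z * c * p" "z * b * v * (p / v) = z * b * p" "z * b * v * c = p * x * v"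
      "p * x * v * (p / v) = p * b * c * z"
      using v0 by (simp_all add: px)
    have zv: "norm (z * v) < 1" using zR v by (simp add: norm_mult)
    have nz3: "p * x * v * q ^ k \<noteq> 1" for k by (rule mult_power_ne_1[OF q1 pxv[OF v]])
    have "w65 q b c (p / v) (z * v) sums
      (qinf q (z * b * v) * qinf q (z * c * v) * qinf q (z * p) * qinf q (p * b * c * z) /
      (qinf q (z * v) * (qinf q (z * c * p) * qinf q (z * b * p) * qinf q (p * x * v))))"
      using w65_sum[OF q1 q0 zv, of c "p / v" b] nz nz3 unfolding par by blast
    from sums_mult[OF this, of "G v * qinf q (p * x * v)"]
    have "(\<lambda>k. G v * qinf q (p * x * v) * w65 q b c (p / v) (z * v) k) sums (\<kappa> * I v)"
      using qinf_nonzero[OF q1 pxv[OF v]] unfolding \<kappa>_def I_def G_def by (simp add: mult_ac)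
    moreover have "G v * qinf q (p * x * v) * w65 q b c (p / v) (z * v) k = F k v" for k
    proof -
      have "qfac q (p * x * v) k \<noteq> 0" by (rule qfac_nonzero[OF q1 pxv[OF v]])
      then have A: "qinf q (p * x * v) / qfac q (p * x * v) k = qinf q (p * x * v * q ^ k)"
        using qinf_split[OF q1, of "p * x * v" k] by simp
      have B: "w65 q b c (p / v) (z * v) k = w54_term q p b c z k * v ^ k * qfac q (p / v) k / qfac q (p * x * v) k"
        unfolding w65_def w54_term_def par by (simp add: power_mult_distrib mult_ac)
      show ?thesis unfolding F_eq[OF v] A[symmetric] B by simp
    qed
    ultimately show ?thesis by simp
  qed
  obtain K where K: "K > 0" "\<And>k. norm (w54_term q p b c z k) \<le> K * norm z ^ k"
    using w54_term_bound[OF nz] by metis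
  obtain C where C: "C > 0" "\<And>v. norm v = norm R \<Longrightarrow> norm (G v) \<le> C"
    using continuous_on_sphere_bounded[OF contG] by metis
  define D where "D = exp (norm p / norm R / (1 - norm q)) * exp (1 / (1 - norm q))"
  have bound: "norm (F k v) \<le> C * K * D * norm (z * R) ^ k" if v: "norm v = norm R" for k v
  proof -
    have "norm (qfac q (p / v) k) \<le> exp (norm p / norm R / (1 - norm q))"
      using norm_qfac_le[OF q1, of "p / v" k] v by (simp add: norm_divide)
    moreover have "norm (qinf q (p * x * v * q ^ k)) \<le> exp (1 / (1 - norm q))"
    proof -
      have "norm (p * x * v) * norm q ^ k \<le> 1 * 1"
        using q1 pxv[OF v] by (intro mult_mono power_le_one) auto
      then have "exp (norm (p * x * v * q ^ k) / (1 - norm q)) \<le> exp (1 / (1 - norm q))"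
        using q1 by (simp add: norm_mult norm_power divide_right_mono)
      with norm_qinf_le[OF q1, of "p * x * v * q ^ k"] show ?thesis by linarith
    qed
    ultimately have D: "norm (qfac q (p / v) k) * norm (qinf q (p * x * v * q ^ k)) \<le> D"
      unfolding D_def by (intro mult_mono) auto
    have "norm (F k v) = norm (G v) * (norm (w54_term q p b c z k) * norm R ^ k *
        (norm (qfac q (p / v) k) * norm (qinf q (p * x * v * q ^ k))))"
      unfolding F_eq[OF v] by (simp add: norm_mult norm_power v mult_ac)
    also have "\<dots> \<le> C * (K * norm z ^ k * norm R ^ k * D)"
      using C(1) K(1) by (intro mult_mono C(2) K(2) D v) auto
    finally show ?thesis by (simp add: norm_mult power_mult_distrib mult_ac)
  qed
  have "summable (\<lambda>k. C * K * D * norm (z * R) ^ k)"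
    using zR by (intro summable_mult summable_geometric) simp
  from cmean_sums[OF contF bound this sums]
  have "(\<lambda>k. cmean R (F k)) sums (\<kappa> * cmean R I)"
    unfolding cmean_cmult by simp
  moreover have "cmean R (F k) = w54_term q p b c z k * (theta q h * theta q (h * p) / (qinf q q * (1 - x)))" for k
  proof -
    have "cmean R (F k) = w54_term q p b c z k * (hfac q 0 (h * p) k *
        (theta q h * theta q (h * (p * q ^ k)) / (qinf q q * (1 - x))))"
      unfolding F_def cmean_cmult
      using kern_balanced_mean[OF q1 q0 h pq(1) R(1) pq(2) xR', of k] by simp
    then show ?thesis
      using theta_shift_power[OF q1 q0, of "h * p" k] h p by (simp add: mult_ac)
  qed
  ultimately show ?thesis unfolding \<kappa>_def I_def x_def by simp
qed

end

text \<open>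
  In the form with square roots the very-well-poised factor consists of the quotients
  \<open>(q ra; q)\<^sub>k / (ra; q)\<^sub>k\<close> and its analogue for \<open>- ra\<close>, which collapse to \<open>(1 \<mp> ra q\<^sup>k) / (1 \<mp> ra)\<close>.
\<close>

lemma vwp_quotient:
  assumes "\<And>j. ra * q ^ j \<noteq> 1" "\<And>j. - ra * q ^ j \<noteq> 1"
  shows "qfac q (ra\<^sup>2) k * qfac q (q * ra) k * qfac q (- (q * ra)) k / (qfac q ra k * qfac q (- ra) k) =
    vwp q (q * ra\<^sup>2) k"
proof (cases k)
  case (Suc j)
  have nz: "qfac q ra n \<noteq> 0" "qfac q (- ra) n \<noteq> 0" for n
    using assms by (auto simp: qfac_eq_0_iff)
  have nz1: "1 - ra \<noteq> 0" "1 + ra \<noteq> 0"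
    using nz[of 1] by (simp_all add: qfac_Suc)
  have 1: "(1 - ra) * qfac q (q * ra) k = qfac q ra k * (1 - ra * q ^ k)"
    using qfac_Suc[of q ra k] qfac_Suc_shift[of q ra k] by (simp add: mult.commute)
  have 2: "(1 + ra) * qfac q (- (q * ra)) k = qfac q (- ra) k * (1 + ra * q ^ k)"
    using qfac_Suc[of q "- ra" k] qfac_Suc_shift[of q "- ra" k] by (simp add: mult.commute)
  have 3: "qfac q (ra\<^sup>2) k = (1 - ra\<^sup>2) * qfac q (q * ra\<^sup>2) j"
    unfolding Suc by (simp add: qfac_Suc_shift mult.commute)
  have 4: "vwp q (q * ra\<^sup>2) k = qfac q (q * ra\<^sup>2) j * (1 - (ra * q ^ k)\<^sup>2)"
  proof -
    have "q * ra\<^sup>2 * q ^ (2 * j + 1) = (ra * q ^ k)\<^sup>2"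
      unfolding Suc by (simp add: power_mult_distrib power2_eq_square power_add mult_2)
    then show ?thesis by (simp add: vwp_def Suc)
  qed
  have "qfac q (ra\<^sup>2) k * qfac q (q * ra) k * qfac q (- (q * ra)) k =
      qfac q (q * ra\<^sup>2) j * ((1 - ra) * qfac q (q * ra) k) * ((1 + ra) * qfac q (- (q * ra)) k)"
    unfolding 3 by (simp add: power2_eq_square algebra_simps)
  also have "\<dots> = vwp q (q * ra\<^sup>2) k * (qfac q ra k * qfac q (- ra) k)"
    unfolding 1 2 4 by (simp add: power2_eq_square algebra_simps)
  finally show ?thesis using nz[of k] by simp
qed (simp add: vwp_def)

lemma qpoch_eq: "qpoch as q k = prod_list (map (\<lambda>a. qfac q a k) as)"
  by (simp add: qpoch_def qfac_def)

lemma qpoch_inf_eq: "qpoch_inf as q = prod_list (map (qinf q) as)"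
  by (simp add: qpoch_inf_def qinf_def[abs_def])

lemma qtheta_eq: "qtheta [x, y] q = theta q x * theta q y"
  by (simp add: qtheta_def qpoch_inf_eq theta_def)

theorem theorem5p1:
  fixes q z a b c h rq rz ra rb rc :: complex and \<tau> :: real
  assumes nonzero: "q \<noteq> 0" "z \<noteq> 0" "a \<noteq> 0" "b \<noteq> 0" "c \<noteq> 0" "h \<noteq> 0"
    and q_less: "norm q < 1" and z_less: "norm z < 1"
    and tau_pos: "\<tau> > 0"
    and roots: "rq\<^sup>2 = q" "rz\<^sup>2 = z" "ra\<^sup>2 = a" "rb\<^sup>2 = b" "rc\<^sup>2 = c"
    and h_root: "h * (rq * ra / (rb * rc * rz)) \<notin> {q powi k | k :: int. True}"
    and denom_series: "\<And>d. d \<in> set (W54_denoms ra a b c q) \<Longrightarrow> d \<notin> {q powi (- int k) | k :: nat. True}"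
    and denom_theta: "qtheta [h, h * (q * a / (b * c * z))] q \<noteq> 0"
    and denom_prefactor: "qpoch_inf [q * a / b, q * a / c, b\<^sup>2 * c\<^sup>2 * z\<^sup>2 / a] q \<noteq> 0"
    and denom_integrand: "\<And>\<eta> w. \<eta> \<in> {-pi..pi} \<Longrightarrow> w = exp (\<i> * complex_of_real \<eta>) \<Longrightarrow>
        qpoch_inf
          (map (\<lambda>x. x * (complex_of_real \<tau> / w))
             [rq * ra / (rb * rc * rz), rb * rc * rz / (rq * ra)] @
           map (\<lambda>x. x * (w / complex_of_real \<tau>))
             [rb * rc * rz, - (rb * rc * rz), rq * rb * rc * rz, - (rq * rb * rc * rz),
              rq * ra * rz / (rb * rc)]) q \<noteq> 0"
    and moduli:
      "norm (complex_of_real \<tau> * (rq * ra / (rb * rc * rz))) < 1"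
      "norm (complex_of_real \<tau> * (rb * rc * rz / (rq * ra))) < 1"
      "norm (rb * rc * rz) / \<tau> < 1"
      "norm (rq * rb * rc * rz) / \<tau> < 1"
      "norm (rq * ra * rz / (rb * rc)) / \<tau> < 1"
  shows "W54 ra a b c q z =
    qpoch_inf [q, q * a, q * a / (b * c), b\<^sup>2 * c\<^sup>2 * z\<^sup>2 / (q * a)] q /
    (2 * complex_of_real pi * qtheta [h, h * (q * a / (b * c * z))] q *
     qpoch_inf [q * a / b, q * a / c, b\<^sup>2 * c\<^sup>2 * z\<^sup>2 / a] q) *
    integral {-pi..pi} (\<lambda>\<eta>. let w = exp (\<i> * complex_of_real \<eta>) in
      qpoch_inf
        (map (\<lambda>x. x * (complex_of_real \<tau> / w))
           [q / h * (rb * rc * rz / (rq * ra)), h * (rq * ra / (rb * rc * rz))] @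
         map (\<lambda>x. x * (w / complex_of_real \<tau>))
           [h * (rq * ra / (rb * rc * rz)), q / h * (rb * rc * rz / (rq * ra)),
            rq * ra * rc * rz / rb, rq * ra * rb * rz / rc,
            rq * (rb * rc * rz) ^ 3 / ra]) q /
      qpoch_inf
        (map (\<lambda>x. x * (complex_of_real \<tau> / w))
           [rq * ra / (rb * rc * rz), rb * rc * rz / (rq * ra)] @
         map (\<lambda>x. x * (w / complex_of_real \<tau>))
           [rb * rc * rz, - (rb * rc * rz), rq * rb * rc * rz, - (rq * rb * rc * rz),
            rq * ra * rz / (rb * rc)]) q)"
proof -
  define t where "t = rq * ra / (rb * rc * rz)"
  define s where "s = rb * rc * rz"
  define p where "p = t\<^sup>2"
  define x where "x = s\<^sup>2 / t\<^sup>2"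
  define R where "R = t / of_real \<tau>"
  have rnz: "rq \<noteq> 0" "rz \<noteq> 0" "ra \<noteq> 0" "rb \<noteq> 0" "rc \<noteq> 0"
    using nonzero roots by auto
  have tnz: "t \<noteq> 0" "s \<noteq> 0" "p \<noteq> 0" "(of_real \<tau> :: complex) \<noteq> 0"
    using rnz tau_pos by (auto simp: t_def s_def p_def)
  have t_inv: "rb * rc * rz / (rq * ra) = 1 / t" by (simp add: t_def)
  have tz: "rq * ra * rz / (rb * rc) = t * z"
    using rnz by (simp add: t_def roots[symmetric] field_simps power2_eq_square)
  have params: "p * b * c * z = q * a" "z * c * p = q * a / b" "z * b * p = q * a / c" "z * p = q * a / (b * c)"
    "b * c * z / p = x" "q * a / (b * c * z) = p" "b\<^sup>2 * c\<^sup>2 * z\<^sup>2 / (q * a) = x" "b\<^sup>2 * c\<^sup>2 * z\<^sup>2 / a = x * q"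
    using rnz unfolding p_def x_def t_def s_def roots[symmetric]
    by (simp_all add: field_simps power2_eq_square)
  have R1: "norm R > 1"
    using moduli(2) tau_pos tnz unfolding t_inv by (simp add: R_def norm_divide norm_mult field_simps)
  have R2: "norm R > norm p"
  proof -
    have "norm t * (\<tau> * norm t) < norm t * 1"
      using moduli(1) tau_pos tnz unfolding t_def[symmetric] by (intro mult_strict_left_mono) (auto simp: norm_mult)
    then show ?thesis using tau_pos by (simp add: R_def p_def norm_divide norm_mult power2_eq_square field_simps)
  qed
  have zR: "norm (z * R) < 1"
    using moduli(5) tau_pos unfolding tz by (simp add: R_def norm_divide norm_mult mult.commute)
  have xR: "norm x * (norm R)\<^sup>2 < 1"
  proof -
    have "norm x * (norm R)\<^sup>2 = (norm s / \<tau>)\<^sup>2"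
      using tnz tau_pos by (simp add: x_def R_def norm_divide norm_power power_divide)
    also have "\<dots> < 1"
      using moduli(3) tau_pos unfolding s_def[symmetric] by (simp add: power_less_one_iff abs_square_less_1)
    finally show ?thesis .
  qed
  have x1: "norm x < 1"
  proof -
    have "norm x * 1 \<le> norm x * (norm R)\<^sup>2"
      using R1 by (intro mult_left_mono) (auto simp: one_le_power)
    with xR show ?thesis by simp
  qed
  have denom_ne: "d * q ^ k \<noteq> 1" if "d \<in> set (W54_denoms ra a b c q)" for d k
  proof
    assume "d * q ^ k = 1"
    then have "d = q powi (- int k)"
      using nonzero(1) by (simp add: power_int_minus field_simps)
    with denom_series[OF that] show False by blast
  qed
  have nz: "ra * q ^ k \<noteq> 1" "- ra * q ^ k \<noteq> 1" "z * c * p * q ^ k \<noteq> 1" "z * b * p * q ^ k \<noteq> 1" for k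
    unfolding params by (rule denom_ne; simp add: W54_denoms_def)+
  define \<Theta> where "\<Theta> = theta q h * theta q (h * p) / (qinf q q * (1 - x))"
  define I where "I v = kern q h p v * (qinf q (z * b * v) * qinf q (z * c * v) * qinf q (q * x * v) /
        (qinf q (z * v) * qinf q (x * v\<^sup>2)))" for v
  have theta_nz: "theta q h * theta q (h * p) \<noteq> 0"
    using denom_theta unfolding params qtheta_eq .
  have qnz: "qinf q q \<noteq> 0" "1 - x \<noteq> 0"
    using qinf_nonzero[OF q_less q_less] x1 by auto
  have \<Theta>: "\<Theta> \<noteq> 0" using theta_nz qnz by (simp add: \<Theta>_def)
  have W54_term: "qpoch [a, q * ra, - (q * ra), b, c] q k / qpoch (q # W54_denoms ra a b c q) q k * z ^ k =
      w54_term q p b c z k" for k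
  proof -
    have "qpoch [a, q * ra, - (q * ra), b, c] q k / qpoch (q # W54_denoms ra a b c q) q k * z ^ k =
       (qfac q a k * qfac q (q * ra) k * qfac q (- (q * ra)) k / (qfac q ra k * qfac q (- ra) k)) *
       (qfac q b k * qfac q c k) * z ^ k / (qfac q q k * (qfac q (q * a / b) k * qfac q (q * a / c) k))"
      unfolding qpoch_eq W54_denoms_def by (simp add: mult_ac)
    also have "\<dots> = w54_term q p b c z k"
      unfolding vwp_quotient[OF nz(1,2), unfolded roots] w54_term_def params ..
    finally show ?thesis .
  qed
  have "(\<lambda>k. w54_term q p b c z k * \<Theta>) sums
     (qinf q (q * a / (b * c)) * qinf q (q * a) / (qinf q (q * a / b) * qinf q (q * a / c)) * cmean R I)"
    using w54_mean[OF q_less nonzero(1,6) tnz(3) R1 R2 zR, of b c] xR nz(3,4)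
    unfolding params \<Theta>_def I_def by blast
  from sums_divide[OF this, of \<Theta>]
  have W: "W54 ra a b c q z = qinf q (q * a / (b * c)) * qinf q (q * a) / (qinf q (q * a / b) * qinf q (q * a / c)) * cmean R I / \<Theta>"
    using \<Theta> unfolding W54_def qhyp_def W54_term by (simp add: sums_iff)
  have x_split: "qinf q x = (1 - x) * qinf q (x * q)" by (rule qinf_step[OF q_less])
  have xq_nz: "qinf q (x * q) \<noteq> 0"
    using denom_prefactor unfolding params by (simp add: qpoch_inf_eq)
  have pre: "qpoch_inf [q, q * a, q * a / (b * c), b\<^sup>2 * c\<^sup>2 * z\<^sup>2 / (q * a)] q /
    (2 * complex_of_real pi * qtheta [h, h * (q * a / (b * c * z))] q *
     qpoch_inf [q * a / b, q * a / c, b\<^sup>2 * c\<^sup>2 * z\<^sup>2 / a] q) * (2 * of_real pi * cmean R I) = W54 ra a b c q z"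
    unfolding params(6-8) qtheta_eq qpoch_inf_eq W \<Theta>_def
    using qnz xq_nz theta_nz by (simp add: x_split mult_ac)
  have integrand: "qpoch_inf
        (map (\<lambda>x. x * (complex_of_real \<tau> / w))
           [q / h * (rb * rc * rz / (rq * ra)), h * (rq * ra / (rb * rc * rz))] @
         map (\<lambda>x. x * (w / complex_of_real \<tau>))
           [h * (rq * ra / (rb * rc * rz)), q / h * (rb * rc * rz / (rq * ra)),
            rq * ra * rc * rz / rb, rq * ra * rb * rz / rc,
            rq * (rb * rc * rz) ^ 3 / ra]) q /
      qpoch_inf
        (map (\<lambda>x. x * (complex_of_real \<tau> / w))
           [rq * ra / (rb * rc * rz), rb * rc * rz / (rq * ra)] @
         map (\<lambda>x. x * (w / complex_of_real \<tau>))
           [rb * rc * rz, - (rb * rc * rz), rq * rb * rc * rz, - (rq * rb * rc * rz),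
            rq * ra * rz / (rb * rc)]) q = I (R * w)" if w: "w \<noteq> 0" for w
  proof -
    define u where "u = w / of_real \<tau>"
    define v where "v = R * w"
    have u: "of_real \<tau> / w = 1 / u" "u \<noteq> 0" and v: "v = t * u"
      using w tnz by (simp_all add: u_def v_def R_def)
    have num: "q / h * (rb * rc * rz / (rq * ra)) * (of_real \<tau> / w) = q / (h * v)"
      "h * (rq * ra / (rb * rc * rz)) * (of_real \<tau> / w) = h * p / v"
      "h * (rq * ra / (rb * rc * rz)) * (w / of_real \<tau>) = h * v"
      "q / h * (rb * rc * rz / (rq * ra)) * (w / of_real \<tau>) = q / (h * p / v)"
      "rq * ra * rc * rz / rb * (w / of_real \<tau>) = z * c * v"
      "rq * ra * rb * rz / rc * (w / of_real \<tau>) = z * b * v"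
      "rq * (rb * rc * rz) ^ 3 / ra * (w / of_real \<tau>) = q * x * v"
      unfolding t_inv t_def[symmetric] u u_def[symmetric] v
      subgoal using tnz u nonzero by (simp add: field_simps)
      subgoal using tnz u nonzero by (simp add: p_def field_simps power2_eq_square)
      subgoal by simp
      subgoal using tnz u nonzero by (simp add: p_def field_simps power2_eq_square)
      subgoal using rnz u by (simp add: t_def roots[symmetric] field_simps power2_eq_square)
      subgoal using rnz u by (simp add: t_def roots[symmetric] field_simps power2_eq_square)
      subgoal using rnz u by (simp add: t_def x_def s_def roots[symmetric] field_simps power2_eq_square power3_eq_cube)
      done
    have den: "rq * ra / (rb * rc * rz) * (of_real \<tau> / w) = p / v"
      "rb * rc * rz / (rq * ra) * (of_real \<tau> / w) = 1 / v"
      "rb * rc * rz * (w / of_real \<tau>) = s * u" "- (rb * rc * rz) * (w / of_real \<tau>) = - (s * u)"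
      "rq * rb * rc * rz * (w / of_real \<tau>) = rq * (s * u)" "- (rq * rb * rc * rz) * (w / of_real \<tau>) = - (rq * (s * u))"
      "rq * ra * rz / (rb * rc) * (w / of_real \<tau>) = z * v"
      unfolding t_inv tz t_def[symmetric] u u_def[symmetric] v s_def
      using tnz u by (simp_all add: p_def power2_eq_square)
    have quad: "qinf q (s * u) * qinf q (- (s * u)) * qinf q (rq * (s * u)) * qinf q (- (rq * (s * u))) = qinf q (x * v\<^sup>2)"
    proof -
      have "(s * u)\<^sup>2 = x * v\<^sup>2" using tnz by (simp add: x_def v power_mult_distrib)
      then show ?thesis using qinf_quadruple[OF q_less roots(1), of "s * u"] by simp
    qed
    show ?thesis
      unfolding v_def[symmetric] I_def kern_def theta_def quad[symmetric] qpoch_inf_eq list.map append.simps num den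
      by (simp add: mult_ac)
  qed
  have "integral {-pi..pi} (\<lambda>\<eta>. let w = exp (\<i> * complex_of_real \<eta>) in
      qpoch_inf
        (map (\<lambda>x. x * (complex_of_real \<tau> / w))
           [q / h * (rb * rc * rz / (rq * ra)), h * (rq * ra / (rb * rc * rz))] @
         map (\<lambda>x. x * (w / complex_of_real \<tau>))
           [h * (rq * ra / (rb * rc * rz)), q / h * (rb * rc * rz / (rq * ra)),
            rq * ra * rc * rz / rb, rq * ra * rb * rz / rc,
            rq * (rb * rc * rz) ^ 3 / ra]) q /
      qpoch_inf
        (map (\<lambda>x. x * (complex_of_real \<tau> / w))
           [rq * ra / (rb * rc * rz), rb * rc * rz / (rq * ra)] @
         map (\<lambda>x. x * (w / complex_of_real \<tau>))
           [rb * rc * rz, - (rb * rc * rz), rq * rb * rc * rz, - (rq * rb * rc * rz),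
            rq * ra * rz / (rb * rc)]) q) = 2 * of_real pi * cmean R I"
    unfolding Let_def cmean_def using integrand[OF exp_not_eq_zero] by simp
  then show ?thesis using pre by simp
qed

end
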